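(* Let $\Phi$ denote a Leonard system of diameter $d$, with eigenvalue sequence $\theta_0,\ldots,\theta_d$, dual eigenvalue sequence $\theta^*_0,\ldots,\theta^*_d$, $\varphi$-sequence $\varphi_1,\ldots,\varphi_d$, and $\phi$-sequence $\phi_1,\ldots,\phi_d$. Then for all $g\in D_4$, the scalars $\theta^g_i$, $\theta^{*g}_i$ ($0\le i\le d$) and $\varphi^g_i$, $\phi^g_i$ ($1\le i\le d$) are as follows. $$\begin{array}{|c||c|c|c|c|}\hline g & \theta^g_i & \theta^{*g}_i & \varphi^g_i & \phi^g_i\\ \hline\hline 1 & \theta_i & \theta^*_i & \varphi_i & \phi_i\\ \hline \downarrow & \theta_i & \theta^*_{d-i} & \phi_{d-i+1} & \varphi_{d-i+1}\\ \hline \Downarrow & \theta_{d-i} & \theta^*_i & \phi_i & \varphi_i\\ \hline \downarrow\Downarrow & \theta_{d-i} & \theta^*_{d-i} & \varphi_{d-i+1} & \phi_{d-i+1}\\ \hline * & \theta^*_i & \theta_i & \varphi_i & \phi_{d-i+1}\\ \hline \downarrow * & \theta^*_i & \theta_{d-i} & \phi_i & \varphi_{d-i+1}\\ \hline \Downarrow * & \theta^*_{d-i} & \theta_i & \phi_{d-i+1} & \varphi_i\\ \hline \downarrow\Downarrow * & \theta^*_{d-i} & \theta_{d-i} & \varphi_{d-i+1} & \phi_i\\ \hline \end{array}$$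
   Context: Let $\mathcal F$ be a field and $\mathcal A$ an $\mathcal F$-algebra isomorphic to $\mathrm{Mat}_{d+1}(\mathcal F)$ (rows and columns indexed by $0,\ldots,d$). An element of $\mathcal A$ is multiplicity-free if it has $d+1$ distinct eigenvalues (roots of its minimal polynomial), all in $\mathcal F$. If $A\in\mathcal A$ is multiplicity-free with eigenvalues $\theta_0,\ldots,\theta_d$, the primitive idempotent of $A$ associated with $\theta_i$ is $E_i=\prod_{j\neq i}(A-\theta_jI)/(\theta_i-\theta_j)$. A Leonard system in $\mathcal A$ is a sequence $\Phi=(A;E_0,\ldots,E_d;A^*;E^*_0,\ldots,E^*_d)$ such that: $A$ and $A^*$ are multiplicity-free elements of $\mathcal A$ ($A^*$ is just another element, not a conjugate-transpose); $E_0,\ldots,E_d$ is an ordering of the primitive idempotents of $A$; $E^*_0,\ldots,E^*_d$ is an ordering of the primitive idempotents of $A^*$; and for $0\le i,j\le d$, both $E_iA^*E_j$ and $E^*_iAE^*_j$ are $0$ if $|i-j|>1$ and are nonzero if $|i-j|=1$. Here $d$ is the diameter of $\Phi$. The eigenvalue sequence $\theta_0,\ldots,\theta_d$ (resp. dual eigenvalue sequence $\theta^*_0,\ldots,\theta^*_d$) of $\Phi$: $\theta_i$ (resp. $\theta^*_i$) is the eigenvalue of $A$ (resp. $A^*$) associated with $E_i$ (resp. $E^*_i$). For every Leonard system $\Phi$ there exist a unique $\mathcal F$-algebra isomorphism $\flat:\mathcal A\to\mathrm{Mat}_{d+1}(\mathcal F)$ and unique scalars $\varphi_1,\ldots,\varphi_d\in\mathcal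 F$ such that $A^\flat$ has $(i,i)$ entry $\theta_i$, $(i,i-1)$ entry $1$ and all other entries $0$, while $A^{*\flat}$ has $(i,i)$ entry $\theta^*_i$, $(i-1,i)$ entry $\varphi_i$ and all other entries $0$. The sequence $\varphi_1,\ldots,\varphi_d$ is the $\varphi$-sequence of $\Phi$. The $\phi$-sequence of $\Phi$ is the $\varphi$-sequence of the Leonard system $\Phi^\Downarrow=(A;E_d,E_{d-1},\ldots,E_0;A^*;E^*_0,\ldots,E^*_d)$. For any Leonard system $\Phi=(A;E_0,\ldots,E_d;A^*;E^*_0,\ldots,E^*_d)$ in $\mathcal A$, the following are Leonard systems in $\mathcal A$: $\Phi^*=(A^*;E^*_0,\ldots,E^*_d;A;E_0,\ldots,E_d)$, $\Phi^\downarrow=(A;E_0,\ldots,E_d;A^*;E^*_d,E^*_{d-1},\ldots,E^*_0)$, $\Phi^\Downarrow=(A;E_d,E_{d-1},\ldots,E_0;A^*;E^*_0,\ldots,E^*_d)$. The dihedral group $D_4$ (of order 8) is generated by symbols $*,\downarrow,\Downarrow$ subject to $*^2=\downarrow^2=\Downarrow^2=1$, $\Downarrow *=*\downarrow$, $\downarrow *=*\Downarrow$, $\downarrow\Downarrow=\Downarrow\downarrow$, and acts on the set of all Leonard systems with $\Phi^{gh}=(\Phi^g)^h$ (e.g. $\Phi^{\downarrow *}=(A^*;E^*_d,\ldots,E^*_0;A;E_0,\ldots,E_d)$). For $g\in D_4$ and any object $f$ associated with $\Phi$, $f^g$ denotes the corresponding object associated with the Leonard system $\Phi^{g^{-1}}$.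 *)

theory Defs
  imports
    "HOL-Computational_Algebra.Polynomial"
    "HOL-Algebra.QuotRing"
    "Jordan_Normal_Form.VS_Connect"
begin

section \<open>Algebras isomorphic to a full matrix algebra\<close>

text \<open>The field is the type \<open>'k\<close>, regarded as the HOL-Algebra ring \<open>class_ring\<close>. The
  locale \<open>algebra\<close> of HOL-Algebra is restricted to commutative algebras, hence the following.\<close>

definition assoc_algebra :: "('k::field, 'a, 'm) module_scheme \<Rightarrow> bool" where
  "assoc_algebra M \<longleftrightarrow>
     Module.module (class_ring :: 'k ring) M \<and> ring M \<and>
     (\<forall>c. \<forall>x\<in>carrier M. \<forall>y\<in>carrier M.
       (c \<odot>\<^bsub>M\<^esub> x) \<otimes>\<^bsub>M\<^esub> y = c \<odot>\<^bsub>M\<^esub> (x \<otimes>\<^bsub>M\<^esub> y) \<and>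
       x \<otimes>\<^bsub>M\<^esub> (c \<odot>\<^bsub>M\<^esub> y) = c \<odot>\<^bsub>M\<^esub> (x \<otimes>\<^bsub>M\<^esub> y))"

definition algebra_iso ::
  "('k, 'a, 'm) module_scheme \<Rightarrow> ('k, 'b, 'n) module_scheme \<Rightarrow> ('a \<Rightarrow> 'b) \<Rightarrow> bool" where
  "algebra_iso M N f \<longleftrightarrow>
     f \<in> ring_iso M N \<and> (\<forall>c. \<forall>x\<in>carrier M. f (c \<odot>\<^bsub>M\<^esub> x) = c \<odot>\<^bsub>N\<^esub> f x)"

abbreviation mat_algebra :: "nat \<Rightarrow> ('k::field, 'k mat) module" where
  "mat_algebra n \<equiv> module_mat TYPE('k) n n"

section \<open>Multiplicity-free elements and primitive idempotents\<close>

definition alg_eval :: "('k::field, 'a, 'm) module_scheme \<Rightarrow> 'k poly \<Rightarrow> 'a \<Rightarrow> 'a" where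
  "alg_eval M p x =
     (\<Oplus>\<^bsub>M\<^esub>i\<in>{..degree p}. Polynomial.coeff p i \<odot>\<^bsub>M\<^esub> (x [^]\<^bsub>M\<^esub> i))"

definition min_poly :: "('k::field, 'a, 'm) module_scheme \<Rightarrow> 'a \<Rightarrow> 'k poly" where
  "min_poly M x = (THE p. lead_coeff p = 1 \<and> alg_eval M p x = \<zero>\<^bsub>M\<^esub> \<and>
     (\<forall>q. q \<noteq> 0 \<and> alg_eval M q x = \<zero>\<^bsub>M\<^esub> \<longrightarrow> degree p \<le> degree q))"

definition eigvals :: "('k::field, 'a, 'm) module_scheme \<Rightarrow> 'a \<Rightarrow> 'k set" where
  "eigvals M x = {t. poly (min_poly M x) t = 0}"

text \<open>Only roots in the field itself are counted here. In an algebra of \<open>(d+1) \<times> (d+1)\<close> matrices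
  the minimal polynomial has degree at most \<open>d + 1\<close>, so \<open>d + 1\<close> distinct roots in the field
  leave no others.\<close>

definition multiplicity_free :: "nat \<Rightarrow> ('k::field, 'a, 'm) module_scheme \<Rightarrow> 'a \<Rightarrow> bool" where
  "multiplicity_free d M x \<longleftrightarrow> x \<in> carrier M \<and> card (eigvals M x) = d + 1"

text \<open>The product of the factors \<open>(x - s I) / (t - s)\<close> over all eigenvalues \<open>s \<noteq> t\<close>. The factors
  commute although the algebra does not, so the product is formed in \<open>'k poly\<close> and then
  evaluated at \<open>x\<close>.\<close>

definition prim_idem :: "('k::field, 'a, 'm) module_scheme \<Rightarrow> 'a \<Rightarrow> 'k \<Rightarrow> 'a" where
  "prim_idem M x t =
     alg_eval M (\<Prod>s\<in>eigvals M x - {t}. Polynomial.smult (1 / (t - s)) [:- s, 1:]) x"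

section \<open>Leonard systems\<close>

text \<open>\<open>LSys A E As Es\<close> stands for \<open>(A; E\<^sub>0, \<dots>, E\<^sub>d; A\<^sup>*; E\<^sup>*\<^sub>0, \<dots>, E\<^sup>*\<^sub>d)\<close>; lists are indexed from 0.\<close>

datatype 'a lsys =
  LSys (elt: 'a) (idems: "'a list") (dual_elt: 'a) (dual_idems: "'a list")

definition ordering_of_prim_idems ::
  "nat \<Rightarrow> ('k::field, 'a, 'm) module_scheme \<Rightarrow> 'a \<Rightarrow> 'a list \<Rightarrow> bool" where
  "ordering_of_prim_idems d M x Es \<longleftrightarrow>
     length Es = d + 1 \<and> distinct Es \<and> set Es = prim_idem M x ` eigvals M x"

definition tridiagonal_on ::
  "nat \<Rightarrow> ('k::field, 'a, 'm) module_scheme \<Rightarrow> 'a list \<Rightarrow> 'a \<Rightarrow> bool" where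
  "tridiagonal_on d M Es x \<longleftrightarrow> (\<forall>i\<le>d. \<forall>j\<le>d.
     (\<bar>int i - int j\<bar> > 1 \<longrightarrow> Es ! i \<otimes>\<^bsub>M\<^esub> x \<otimes>\<^bsub>M\<^esub> Es ! j = \<zero>\<^bsub>M\<^esub>) \<and>
     (\<bar>int i - int j\<bar> = 1 \<longrightarrow> Es ! i \<otimes>\<^bsub>M\<^esub> x \<otimes>\<^bsub>M\<^esub> Es ! j \<noteq> \<zero>\<^bsub>M\<^esub>))"

definition leonard_system ::
  "nat \<Rightarrow> ('k::field, 'a, 'm) module_scheme \<Rightarrow> 'a lsys \<Rightarrow> bool" where
  "leonard_system d M \<Phi> \<longleftrightarrow>
     assoc_algebra M \<and> (\<exists>f. algebra_iso M (mat_algebra (d + 1)) f) \<and>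
     multiplicity_free d M (elt \<Phi>) \<and> multiplicity_free d M (dual_elt \<Phi>) \<and>
     ordering_of_prim_idems d M (elt \<Phi>) (idems \<Phi>) \<and>
     ordering_of_prim_idems d M (dual_elt \<Phi>) (dual_idems \<Phi>) \<and>
     tridiagonal_on d M (idems \<Phi>) (dual_elt \<Phi>) \<and>
     tridiagonal_on d M (dual_idems \<Phi>) (elt \<Phi>)"

definition eigenvalue_seq :: "('k::field, 'a, 'm) module_scheme \<Rightarrow> 'a lsys \<Rightarrow> nat \<Rightarrow> 'k" where
  "eigenvalue_seq M \<Phi> i =
     (THE t. t \<in> eigvals M (elt \<Phi>) \<and> prim_idem M (elt \<Phi>) t = idems \<Phi> ! i)"

definition dual_eigenvalue_seq :: "('k::field, 'a, 'm) module_scheme \<Rightarrow> 'a lsys \<Rightarrow> nat \<Rightarrow> 'k" where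
  "dual_eigenvalue_seq M \<Phi> i =
     (THE t. t \<in> eigvals M (dual_elt \<Phi>) \<and> prim_idem M (dual_elt \<Phi>) t = dual_idems \<Phi> ! i)"

definition split_form ::
  "nat \<Rightarrow> ('k::field, 'a, 'm) module_scheme \<Rightarrow> 'a lsys \<Rightarrow> ('a \<Rightarrow> 'k mat) \<Rightarrow> (nat \<Rightarrow> 'k) \<Rightarrow> bool"
  where
  "split_form d M \<Phi> f vp \<longleftrightarrow>
     algebra_iso M (mat_algebra (d + 1)) f \<and>
     f (elt \<Phi>) = mat (d + 1) (d + 1) (\<lambda>(i, j).
       if i = j then eigenvalue_seq M \<Phi> i else if i = j + 1 then 1 else 0) \<and>
     f (dual_elt \<Phi>) = mat (d + 1) (d + 1) (\<lambda>(i, j).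
       if i = j then dual_eigenvalue_seq M \<Phi> i else if j = i + 1 then vp j else 0)"

text \<open>The sequence has index set \<open>{1..d}\<close>; requiring it to be \<open>extensional\<close> fixes the irrelevant
  values outside, so that the description picks out a unique function.\<close>

definition varphi_seq :: "nat \<Rightarrow> ('k::field, 'a, 'm) module_scheme \<Rightarrow> 'a lsys \<Rightarrow> nat \<Rightarrow> 'k" where
  "varphi_seq d M \<Phi> = (THE vp. vp \<in> extensional {1..d} \<and> (\<exists>f. split_form d M \<Phi> f vp))"

section \<open>The group D4 and its action\<close>

datatype d4_gen = Star | Down | DDown

fun gen_act :: "d4_gen \<Rightarrow> 'a lsys \<Rightarrow> 'a lsys" where
  "gen_act Star (LSys A E As Es) = LSys As Es A E"
| "gen_act Down (LSys A E As Es) = LSys A E As (rev Es)"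
| "gen_act DDown (LSys A E As Es) = LSys A (rev E) As Es"

definition phi_seq :: "nat \<Rightarrow> ('k::field, 'a, 'm) module_scheme \<Rightarrow> 'a lsys \<Rightarrow> nat \<Rightarrow> 'k" where
  "phi_seq d M \<Phi> = varphi_seq d M (gen_act DDown \<Phi>)"

text \<open>\<open>D4\<close> is the group presented by the generators and relations: words modulo the least
  congruence containing the relations. The generators being involutions, no formal inverses
  are needed.\<close>

inductive d4_eq :: "d4_gen list \<Rightarrow> d4_gen list \<Rightarrow> bool" where
  star_star: "d4_eq [Star, Star] []"
| down_down: "d4_eq [Down, Down] []"
| ddown_ddown: "d4_eq [DDown, DDown] []"
| ddown_star: "d4_eq [DDown, Star] [Star, Down]"
| down_star: "d4_eq [Down, Star] [Star, DDown]"
| down_ddown: "d4_eq [Down, DDown] [DDown, Down]"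
| refl: "d4_eq u u"
| sym: "d4_eq u v \<Longrightarrow> d4_eq v u"
| trans: "d4_eq u v \<Longrightarrow> d4_eq v w \<Longrightarrow> d4_eq u w"
| app: "d4_eq u v \<Longrightarrow> d4_eq u' v' \<Longrightarrow> d4_eq (u @ u') (v @ v')"

quotient_type d4 = "d4_gen list" / d4_eq
  by (rule equivpI) (auto simp: reflp_def symp_def transp_def intro: d4_eq.intros)

lift_definition d4_mult :: "d4 \<Rightarrow> d4 \<Rightarrow> d4" is "(@)"
  by (rule d4_eq.app)

lift_definition d4_one :: d4 is "[]" .

lift_definition d4_gen :: "d4_gen \<Rightarrow> d4" is "\<lambda>x. [x]" .

definition D4 :: "d4 monoid" where
  "D4 = \<lparr>carrier = UNIV, mult = d4_mult, one = d4_one\<rparr>"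

lemma d4_eq_rev_cancel: "d4_eq (rev u @ u) []"
proof (induction u)
  case Nil
  show ?case by (simp add: d4_eq.refl)
next
  case (Cons x u)
  have "d4_eq [x, x] []"
    by (cases x) (simp_all add: d4_eq.intros(1-3))
  then have "d4_eq ([x, x] @ u) u"
    using d4_eq.app[OF _ d4_eq.refl, of "[x, x]" "[]" u] by simp
  then have "d4_eq (rev u @ ([x, x] @ u)) (rev u @ u)"
    by (rule d4_eq.app[OF d4_eq.refl])
  with Cons.IH show ?case by (auto intro: d4_eq.trans)
qed

lemma group_D4: "group D4"
proof (rule groupI)
  fix x y z :: d4
  show "(x \<otimes>\<^bsub>D4\<^esub> y) \<otimes>\<^bsub>D4\<^esub> z = x \<otimes>\<^bsub>D4\<^esub> (y \<otimes>\<^bsub>D4\<^esub> z)"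
    unfolding D4_def by simp (transfer, simp add: d4_eq.refl)
  show "\<one>\<^bsub>D4\<^esub> \<otimes>\<^bsub>D4\<^esub> x = x"
    unfolding D4_def by simp (transfer, simp add: d4_eq.refl)
  show "\<exists>y\<in>carrier D4. y \<otimes>\<^bsub>D4\<^esub> x = \<one>\<^bsub>D4\<^esub>"
    unfolding D4_def by simp (transfer, auto intro: d4_eq_rev_cancel)
qed (auto simp: D4_def)

text \<open>Right action: the leftmost letter of a word acts first.\<close>

lift_definition lsys_act :: "'a lsys \<Rightarrow> d4 \<Rightarrow> 'a lsys" is "\<lambda>\<Phi> w. fold gen_act w \<Phi>"
proof -
  fix \<Phi> :: "'a lsys" and u v
  assume "d4_eq u v"
  then show "fold gen_act u \<Phi> = fold gen_act v \<Phi>"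
    by (induction arbitrary: \<Phi>) (case_tac \<Phi>; simp; fail | simp)+
qed

lemma lsys_act_one: "lsys_act \<Phi> \<one>\<^bsub>D4\<^esub> = \<Phi>"
  unfolding D4_def by simp (transfer, simp)

lemma lsys_act_mult: "lsys_act \<Phi> (g \<otimes>\<^bsub>D4\<^esub> h) = lsys_act (lsys_act \<Phi> g) h"
  unfolding D4_def by simp (transfer, simp)

lemma lsys_act_gen: "lsys_act \<Phi> (d4_gen x) = gen_act x \<Phi>"
  by transfer simp

text \<open>\<open>f\<^sup>g\<close> for an object \<open>f\<close> depending on a Leonard system is \<open>f\<close> of the system \<open>\<Phi>\<close> acted upon by
  the inverse of \<open>g\<close>.\<close>

definition conj_obj :: "('a lsys \<Rightarrow> 'b) \<Rightarrow> 'a lsys \<Rightarrow> d4 \<Rightarrow> 'b" where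
  "conj_obj f \<Phi> g = f (lsys_act \<Phi> (inv\<^bsub>D4\<^esub> g))"

abbreviation d4_times :: "d4 \<Rightarrow> d4 \<Rightarrow> d4" (infixl \<open>\<cdot>\<close> 70) where
  "g \<cdot> h \<equiv> g \<otimes>\<^bsub>D4\<^esub> h"
abbreviation one4 :: d4 where "one4 \<equiv> \<one>\<^bsub>D4\<^esub>"
abbreviation star :: d4 where "star \<equiv> d4_gen Star"
abbreviation down :: d4 where "down \<equiv> d4_gen Down"
abbreviation ddown :: d4 where "ddown \<equiv> d4_gen DDown"

lemma d4_relations:
  "star \<cdot> star = one4" "down \<cdot> down = one4" "ddown \<cdot> ddown = one4"
  "ddown \<cdot> star = star \<cdot> down" "down \<cdot> star = star \<cdot> ddown" "down \<cdot> ddown = ddown \<cdot> down"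
  unfolding D4_def by simp_all (transfer, simp add: d4_eq.intros(1-6))+

lemma carrier_D4:
  "carrier D4 =
     {one4, down, ddown, down \<cdot> ddown, star, down \<cdot> star, ddown \<cdot> star, down \<cdot> ddown \<cdot> star}"
  (is "_ = ?S")
proof -
  interpret D4: group D4 by (rule group_D4)
  have c [simp]: "x \<in> carrier D4" for x by (simp add: D4_def)
  have k: "down \<cdot> (down \<cdot> x) = x" "ddown \<cdot> (ddown \<cdot> x) = x" "ddown \<cdot> (down \<cdot> x) = down \<cdot> (ddown \<cdot> x)"
    "star \<cdot> (down \<cdot> x) = ddown \<cdot> (star \<cdot> x)" "star \<cdot> (ddown \<cdot> x) = down \<cdot> (star \<cdot> x)"
    "star \<cdot> (star \<cdot> x) = x" for x
    by (simp_all add: D4.m_assoc[symmetric] d4_relations)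
  have gen: "d4_gen a \<cdot> s \<in> ?S" if "s \<in> ?S" for a s
    using that
    by (cases a)
      (auto simp: D4.m_assoc k d4_relations(1-3) d4_relations(4,5)[symmetric] d4_relations(6)[symmetric])
  have word: "abs_d4 w \<in> ?S" for w
  proof (induction w)
    case Nil
    have "abs_d4 [] = one4" by (simp add: D4_def d4_one.abs_eq)
    then show ?case by simp
  next
    case (Cons a w)
    have "abs_d4 (a # w) = d4_gen a \<cdot> abs_d4 w"
      by (simp add: D4_def d4_gen.abs_eq d4_mult.abs_eq)
    then show ?case using gen[OF Cons.IH] by simp
  qed
  have "g \<in> ?S" for g
    by (induct g rule: d4.abs_induct) (rule word)
  then show ?thesis by auto
qed

text \<open>The eight elements just listed are pairwise distinct, so the group has order 8.\<close>

lemma card_D4: "card (carrier D4) = 8"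
proof -
  let ?t = "lsys_act (LSys (0::nat) [0, 1] 1 [2, 3])"
  let ?L = "[one4, down, ddown, down \<cdot> ddown, star, down \<cdot> star, ddown \<cdot> star, down \<cdot> ddown \<cdot> star]"
  have "distinct (map ?t ?L)"
    by (simp add: lsys_act_one lsys_act_mult lsys_act_gen)
  then have "distinct ?L" by (rule distinct_map[THEN iffD1, THEN conjunct1])
  moreover have "carrier D4 = set ?L" by (simp only: carrier_D4 list.set)
  ultimately have "card (carrier D4) = length ?L" by (simp only: distinct_card)
  then show ?thesis by simp
qed

text \<open>By \<open>carrier_D4\<close> a row for each of the eight elements covers every \<open>g\<close> in \<open>D4\<close>.\<close>

definition table_row ::
  "nat \<Rightarrow> ('k::field, 'a, 'm) module_scheme \<Rightarrow> 'a lsys \<Rightarrow> d4 \<Rightarrow>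
    (nat \<Rightarrow> 'k) \<Rightarrow> (nat \<Rightarrow> 'k) \<Rightarrow> (nat \<Rightarrow> 'k) \<Rightarrow> (nat \<Rightarrow> 'k) \<Rightarrow> bool" where
  "table_row d M \<Phi> g t ts v p \<longleftrightarrow>
     (\<forall>i\<in>{0..d}. conj_obj (eigenvalue_seq M) \<Phi> g i = t i \<and>
                  conj_obj (dual_eigenvalue_seq M) \<Phi> g i = ts i) \<and>
     (\<forall>i\<in>{1..d}. conj_obj (varphi_seq d M) \<Phi> g i = v i \<and>
                  conj_obj (phi_seq d M) \<Phi> g i = p i)"

end

theory Submission
  imports Defs
begin

text \<open>Diagonalizing \<open>A\<close> and \<open>A\<^sup>*\<close> turns a Leonard system into an invertible matrix \<open>B\<close> (the change of
  basis between the two eigenbases) for which \<open>X = B \<Theta> B\<^sup>-\<^sup>1\<close> and \<open>Y = B\<^sup>-\<^sup>1 \<Theta>\<^sup>* B\<close> are both irreducible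
  tridiagonal. If \<open>v\<close> spans the image of \<open>E\<^sup>*\<^sub>0\<close>, then the vectors \<open>(A - \<theta>\<^sub>0) \<cdots> (A - \<theta>\<^sub>j\<^sub>-\<^sub>1) v\<close> form the basis
  that realizes the split form, and the superdiagonal entries obtained in this way are nonzero. The
  split form is unique because an automorphism of the matrix algebra is intertwined by a matrix \<open>S\<close>,
  and comparing columns from left to right forces \<open>S\<close> to be scalar.

  An irreducible tridiagonal matrix is symmetrized by an invertible diagonal matrix, which commutes with
  diagonal matrices; hence \<open>A\<close> and \<open>A\<^sup>*\<close> are simultaneously similar to their transposes.
  Transposing the split form and rescaling the basis gives the split form of \<open>\<Phi>\<^sup>*\<close>, while reversing the
  basis and rescaling gives that of \<open>\<Phi>\<close> with both orderings reversed and the roles of \<open>A\<close> and \<open>A\<^sup>*\<close>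
  exchanged. All rows of the table follow from these two symmetries.\<close>

section \<open>Bidiagonal and tridiagonal matrices\<close>

lemma mult_mat_entry:
  assumes "A \<in> carrier_mat n m" "B \<in> carrier_mat m l" "i < n" "j < l"
  shows "(A * B) $$ (i, j) = (\<Sum>k<m. A $$ (i, k) * B $$ (k, j))"
  using assms by (auto simp: scalar_prod_def atLeast0LessThan intro!: sum.cong)

text \<open>The inverse is carried along as an explicit second matrix, so that conjugations can be
  written and cancelled by rewriting alone.\<close>

definition mutual_inverse :: "nat \<Rightarrow> 'k::field mat \<Rightarrow> 'k mat \<Rightarrow> bool" where
  "mutual_inverse n P P' \<longleftrightarrow> P \<in> carrier_mat n n \<and> P' \<in> carrier_mat n n \<and>
     P * P' = 1\<^sub>m n \<and> P' * P = 1\<^sub>m n"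

lemma mutual_inverse_sym: "mutual_inverse n P P' \<Longrightarrow> mutual_inverse n P' P"
  by (simp add: mutual_inverse_def)

lemma mutual_inverse_cancel:
  assumes "mutual_inverse n P P'" "Z \<in> carrier_mat n m"
  shows "P * (P' * Z) = Z" "P' * (P * Z) = Z"
  using assms assoc_mult_mat[of P n n P' n Z m] assoc_mult_mat[of P' n n P n Z m]
  by (simp_all add: mutual_inverse_def)

lemma mutual_inverse_mult:
  assumes P: "mutual_inverse n P P'" and R: "mutual_inverse n R R'"
  shows "mutual_inverse n (P * R) (R' * P')"
proof -
  have c: "P \<in> carrier_mat n n" "P' \<in> carrier_mat n n" "R \<in> carrier_mat n n" "R' \<in> carrier_mat n n"
    and one: "P * P' = 1\<^sub>m n" "R' * R = 1\<^sub>m n"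
    using assms by (simp_all add: mutual_inverse_def)
  have "P * R * (R' * P') = P * (R * (R' * P'))" "R' * P' * (P * R) = R' * (P' * (P * R))"
    using c by (simp_all add: assoc_mult_mat[of _ n n _ n _ n])
  then show ?thesis
    using c one mutual_inverse_cancel(1)[OF R c(2)] mutual_inverse_cancel(2)[OF P c(3)]
    by (simp add: mutual_inverse_def)
qed

lemma mutual_inverse_of_det:
  assumes "P \<in> carrier_mat n n" "det P \<noteq> 0"
  obtains P' where "mutual_inverse n P P'"
  using det_non_zero_imp_unit[OF assms, of "()"] assms
  by (auto simp: Units_def ring_mat_def mutual_inverse_def)

lemma mutual_inverse_det:
  assumes "mutual_inverse n P P'"
  shows "det P \<noteq> 0"
proof -
  have "det P * det P' = det (P * P')"
    using assms by (intro det_mult[symmetric, of _ n]) (auto simp: mutual_inverse_def)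
  then show ?thesis using assms by (auto simp: mutual_inverse_def)
qed

section \<open>Diagonal and bidiagonal matrices\<close>

definition diag_of :: "nat \<Rightarrow> (nat \<Rightarrow> 'k::field) \<Rightarrow> 'k mat" where
  "diag_of n t = mat n n (\<lambda>(i, j). if i = j then t i else 0)"

text \<open>Off-diagonal entries are numbered by the larger of the two indices (row here, column in
  \<open>upper_bidiag\<close>), so transposition exchanges the two shapes without shifting
  \<open>v\<close>.\<close>

definition lower_bidiag :: "nat \<Rightarrow> (nat \<Rightarrow> 'k::field) \<Rightarrow> (nat \<Rightarrow> 'k) \<Rightarrow> 'k mat" where
  "lower_bidiag n t v = mat n n (\<lambda>(i, j). if i = j then t i else if i = j + 1 then v i else 0)"

definition upper_bidiag :: "nat \<Rightarrow> (nat \<Rightarrow> 'k::field) \<Rightarrow> (nat \<Rightarrow> 'k) \<Rightarrow> 'k mat" where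
  "upper_bidiag n t v = mat n n (\<lambda>(i, j). if i = j then t i else if j = i + 1 then v j else 0)"

lemma bidiag_carrier [simp]:
  "diag_of n t \<in> carrier_mat n n" "lower_bidiag n t v \<in> carrier_mat n n"
  "upper_bidiag n t v \<in> carrier_mat n n"
  by (auto simp: diag_of_def lower_bidiag_def upper_bidiag_def)

lemma bidiag_dim [simp]:
  "dim_row (diag_of n t) = n" "dim_col (diag_of n t) = n"
  "dim_row (lower_bidiag n t v) = n" "dim_col (lower_bidiag n t v) = n"
  "dim_row (upper_bidiag n t v) = n" "dim_col (upper_bidiag n t v) = n"
  by (auto simp: diag_of_def lower_bidiag_def upper_bidiag_def)

lemma diag_of_mult_entry:
  assumes "A \<in> carrier_mat n m" "i < n" "j < m"
  shows "(diag_of n t * A) $$ (i, j) = t i * A $$ (i, j)"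
proof -
  have "(diag_of n t * A) $$ (i, j) = (\<Sum>k<n. if k = i then t i * A $$ (i, j) else 0)"
    unfolding mult_mat_entry[OF bidiag_carrier(1) assms]
    by (rule sum.cong) (use assms in \<open>auto simp: diag_of_def\<close>)
  then show ?thesis using assms by simp
qed

lemma mult_diag_of_entry:
  assumes "A \<in> carrier_mat m n" "i < m" "j < n"
  shows "(A * diag_of n t) $$ (i, j) = A $$ (i, j) * t j"
proof -
  have "(A * diag_of n t) $$ (i, j) = (\<Sum>k<n. if k = j then A $$ (i, j) * t j else 0)"
    unfolding mult_mat_entry[OF assms(1) bidiag_carrier(1) assms(2,3)]
    by (rule sum.cong) (use assms in \<open>auto simp: diag_of_def\<close>)
  then show ?thesis using assms by simp
qed

lemma mult_lower_bidiag_entry: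
  assumes "A \<in> carrier_mat m n" "i < m" "j < n"
  shows "(A * lower_bidiag n t v) $$ (i, j) =
    A $$ (i, j) * t j + (if j + 1 < n then A $$ (i, j + 1) * v (j + 1) else 0)"
proof -
  have "(A * lower_bidiag n t v) $$ (i, j) =
      (\<Sum>k<n. (if k = j then A $$ (i, j) * t j else 0) +
               (if k = j + 1 then A $$ (i, j + 1) * v (j + 1) else 0))"
    unfolding mult_mat_entry[OF assms(1) bidiag_carrier(2) assms(2,3)]
    by (rule sum.cong) (use assms in \<open>auto simp: lower_bidiag_def\<close>)
  then show ?thesis using assms by (simp add: sum.distrib)
qed

lemma lower_bidiag_mult_entry:
  assumes "A \<in> carrier_mat n m" "i < n" "j < m"
  shows "(lower_bidiag n t v * A) $$ (i, j) =
    t i * A $$ (i, j) + (if 0 < i then v i * A $$ (i - 1, j) else 0)"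
proof -
  have "(lower_bidiag n t v * A) $$ (i, j) =
      (\<Sum>k<n. (if k = i then t i * A $$ (i, j) else 0) +
               (if k = i - 1 then if 0 < i then v i * A $$ (i - 1, j) else 0 else 0))"
    unfolding mult_mat_entry[OF bidiag_carrier(2) assms]
    by (rule sum.cong) (use assms in \<open>auto simp: lower_bidiag_def\<close>)
  then show ?thesis using assms by (simp add: sum.distrib)
qed

lemma upper_bidiag_mult_entry:
  assumes "A \<in> carrier_mat n m" "i < n" "j < m"
  shows "(upper_bidiag n t v * A) $$ (i, j) =
    t i * A $$ (i, j) + (if i + 1 < n then v (i + 1) * A $$ (i + 1, j) else 0)"
proof -
  have "(upper_bidiag n t v * A) $$ (i, j) =
      (\<Sum>k<n. (if k = i then t i * A $$ (i, j) else 0) +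
               (if k = i + 1 then v (i + 1) * A $$ (i + 1, j) else 0))"
    unfolding mult_mat_entry[OF bidiag_carrier(3) assms]
    by (rule sum.cong) (use assms in \<open>auto simp: upper_bidiag_def\<close>)
  then show ?thesis using assms by (simp add: sum.distrib)
qed

lemma mult_upper_bidiag_entry:
  assumes "A \<in> carrier_mat m n" "i < m" "j < n"
  shows "(A * upper_bidiag n t v) $$ (i, j) =
    A $$ (i, j) * t j + (if 0 < j then A $$ (i, j - 1) * v j else 0)"
proof -
  have "(A * upper_bidiag n t v) $$ (i, j) =
      (\<Sum>k<n. (if k = j then A $$ (i, j) * t j else 0) +
               (if k = j - 1 then if 0 < j then A $$ (i, j - 1) * v j else 0 else 0))"
    unfolding mult_mat_entry[OF assms(1) bidiag_carrier(3) assms(2,3)]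
    by (rule sum.cong) (use assms in \<open>auto simp: upper_bidiag_def\<close>)
  then show ?thesis using assms by (simp add: sum.distrib)
qed

lemma transpose_bidiag:
  "transpose_mat (lower_bidiag n t v) = upper_bidiag n t v"
  "transpose_mat (upper_bidiag n t v) = lower_bidiag n t v"
  "transpose_mat (diag_of n t) = diag_of n t"
  by (rule eq_matI; auto simp: lower_bidiag_def upper_bidiag_def diag_of_def)+

lemma diag_of_mult_diag_of: "diag_of n s * diag_of n t = diag_of n (\<lambda>i. s i * t i)"
  by (rule eq_matI)
     (simp_all add: diag_of_mult_entry[of "diag_of n t" n n] del: index_mult_mat(1),
      auto simp: diag_of_def)

lemma mutual_inverse_diag:
  assumes "\<And>i. i < n \<Longrightarrow> g i \<noteq> 0"
  shows "mutual_inverse n (diag_of n g) (diag_of n (\<lambda>i. inverse (g i)))"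
  using assms
  by (auto simp: mutual_inverse_def diag_of_mult_diag_of) (auto simp: diag_of_def intro!: eq_matI)

section \<open>Tridiagonal matrices and simultaneous bidiagonalization\<close>

definition irred_tridiag :: "nat \<Rightarrow> 'k::field mat \<Rightarrow> bool" where
  "irred_tridiag n X \<longleftrightarrow> (\<forall>i<n. \<forall>j<n.
     (\<bar>int i - int j\<bar> > 1 \<longrightarrow> X $$ (i, j) = 0) \<and> (\<bar>int i - int j\<bar> = 1 \<longrightarrow> X $$ (i, j) \<noteq> 0))"

text \<open>Symmetry of \<open>diag_of n k * Y\<close> constrains neighbouring indices only, and
  there it is a first-order recursion for \<open>k\<close>, solvable because the off-diagonal
  entries are nonzero.\<close>

lemma tridiag_symmetrizer:
  assumes Y: "Y \<in> carrier_mat n n" "irred_tridiag n Y"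
  obtains k :: "nat \<Rightarrow> 'k::field" where "\<And>i. i < n \<Longrightarrow> k i \<noteq> 0"
    "diag_of n k * Y = transpose_mat Y * diag_of n k"
proof
  \<comment> \<open>The solution of
    \<open>k i * Y $$ (i, i + 1) = Y $$ (i + 1, i) * k (i + 1)\<close> with
    \<open>k 0 = 1\<close>.\<close>
  define k where "k i = (\<Prod>h<i. Y $$ (h, h + 1) / Y $$ (h + 1, h))" for i
  show "k i \<noteq> 0" if "i < n" for i
    using that Y(2) by (auto simp: k_def irred_tridiag_def)
  have step: "k i * Y $$ (i, i + 1) = Y $$ (i + 1, i) * k (i + 1)" if "i + 1 < n" for i
  proof -
    have "Y $$ (i + 1, i) \<noteq> 0" using that Y(2) by (auto simp: irred_tridiag_def)
    then show ?thesis by (simp add: k_def field_simps)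
  qed
  show "diag_of n k * Y = transpose_mat Y * diag_of n k"
  proof (rule eq_matI)
    fix i j assume "i < dim_row (transpose_mat Y * diag_of n k)" "j < dim_col (transpose_mat Y * diag_of n k)"
    then have ij: "i < n" "j < n" using Y by auto
    have "k i * Y $$ (i, j) = Y $$ (j, i) * k j"
    proof -
      consider "i = j" | "j = i + 1" | "i = j + 1" | "\<bar>int i - int j\<bar> > 1" by linarith
      then show ?thesis
      proof cases
        case 4
        then have "\<bar>int j - int i\<bar> > 1" by linarith
        then show ?thesis using 4 ij Y(2) by (auto simp: irred_tridiag_def)
      qed (use step ij in \<open>auto simp: mult.commute\<close>)
    qed
    then show "(diag_of n k * Y) $$ (i, j) = (transpose_mat Y * diag_of n k) $$ (i, j)"
      using ij Y by (simp add: diag_of_mult_entry[of Y n n] mult_diag_of_entry[of _ n n] del: index_mult_mat(1))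
  qed (use Y in auto)
qed

text \<open>Row \<open>i\<close> of \<open>C\<close> ends at the diagonal and column
  \<open>j\<close> of \<open>Z\<close> vanishes above row \<open>i\<close>, so only
  \<open>k = i\<close> survives. This drives inductions from the top row down that recover
  \<open>Z\<close> from \<open>C * Z\<close>.\<close>

lemma lower_triangular_mult_entry:
  assumes C: "C \<in> carrier_mat n n" "\<And>i j. i < j \<Longrightarrow> j < n \<Longrightarrow> C $$ (i, j) = 0"
    and Z: "Z \<in> carrier_mat n m" "\<And>k. k < i \<Longrightarrow> Z $$ (k, j) = 0" and ij: "i < n" "j < m"
  shows "(C * Z) $$ (i, j) = C $$ (i, i) * Z $$ (i, j)"
proof -
  have "(C * Z) $$ (i, j) = (\<Sum>k<n. if k = i then C $$ (i, i) * Z $$ (i, j) else 0)"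
    unfolding mult_mat_entry[OF C(1) Z(1) ij]
  proof (rule sum.cong)
    fix k assume "k \<in> {..<n}"
    then show "C $$ (i, k) * Z $$ (k, j) = (if k = i then C $$ (i, i) * Z $$ (i, j) else 0)"
      using C(2) Z(2) by (cases k i rule: linorder_cases) auto
  qed simp
  then show ?thesis using ij by simp
qed

text \<open>The mirror image, for inductions from the bottom row up.\<close>

lemma upper_triangular_mult_entry:
  assumes C: "C \<in> carrier_mat n n" "\<And>i j. j < i \<Longrightarrow> i < n \<Longrightarrow> C $$ (i, j) = 0"
    and Z: "Z \<in> carrier_mat n m" "\<And>k. i < k \<Longrightarrow> k < n \<Longrightarrow> Z $$ (k, j) = 0" and ij: "i < n" "j < m"
  shows "(C * Z) $$ (i, j) = C $$ (i, i) * Z $$ (i, j)"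
proof -
  have "(C * Z) $$ (i, j) = (\<Sum>k<n. if k = i then C $$ (i, i) * Z $$ (i, j) else 0)"
    unfolding mult_mat_entry[OF C(1) Z(1) ij]
  proof (rule sum.cong)
    fix k assume "k \<in> {..<n}"
    then show "C $$ (i, k) * Z $$ (k, j) = (if k = i then C $$ (i, i) * Z $$ (i, j) else 0)"
      using C(2) Z(2) ij by (cases k i rule: linorder_cases) auto
  qed simp
  then show ?thesis using ij by simp
qed

text \<open>In the eigenbasis of \<open>X\<close> the vector \<open>(X - t\<^sub>0) \<cdots> (X - t\<^sub>j\<^sub>-\<^sub>1) e\<^sub>0\<close> has coordinates
  \<open>B'\<^sub>i\<^sub>0 (t\<^sub>i - t\<^sub>0) \<cdots> (t\<^sub>i - t\<^sub>j\<^sub>-\<^sub>1)\<close>. They are the columns of the lower triangular matrix \<open>C\<close>. The same vectors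
  in the standard basis are the columns of \<open>Q = B C\<close>, which is upper triangular since \<open>X\<close> is tridiagonal.\<close>

lemma bidiagonalization:
  fixes B B' X Y :: "'k::field mat" and t ts :: "nat \<Rightarrow> 'k"
  assumes n: "0 < n" and B: "mutual_inverse n B B'"
    and X: "X = B * (diag_of n t * B')" "irred_tridiag n X"
    and Y: "Y = B' * (diag_of n ts * B)" "irred_tridiag n Y"
  obtains Q Q' C vp where "mutual_inverse n Q Q'"
    "Q' * (X * Q) = lower_bidiag n t (\<lambda>_. 1)"
    "Q' * (diag_of n ts * Q) = upper_bidiag n ts vp"
    "\<And>i. 0 < i \<Longrightarrow> i < n \<Longrightarrow> vp i \<noteq> 0"
    "C \<in> carrier_mat n n" "det C \<noteq> 0"
    "diag_of n t * C = C * lower_bidiag n t (\<lambda>_. 1)"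
    "C * upper_bidiag n ts vp = Y * C"
proof -
  note assoc = assoc_mult_mat[of _ n n _ n _ n] mult_carrier_mat[of _ n n _ n]
  have Bc [simp]: "B \<in> carrier_mat n n" "B' \<in> carrier_mat n n" and inv: "B * B' = 1\<^sub>m n" "B' * B = 1\<^sub>m n"
    using B by (auto simp: mutual_inverse_def)
  have Xc [simp]: "X \<in> carrier_mat n n" and Yc [simp]: "Y \<in> carrier_mat n n"
    by (auto simp: X(1) Y(1) intro!: mult_carrier_mat[of _ n n])
  let ?L = "lower_bidiag n t (\<lambda>_. 1)"
  define C where "C = mat n n (\<lambda>(i, j). B' $$ (i, 0) * (\<Prod>h<j. t i - t h))"
  define Q where "Q = B * C"
  have Cc [simp]: "C \<in> carrier_mat n n" by (simp add: C_def)
  have Qc [simp]: "Q \<in> carrier_mat n n" by (auto simp: Q_def intro!: mult_carrier_mat[of _ n n])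
  have dims [simp]: "dim_row Q = n" "dim_col Q = n" "dim_row C = n" "dim_col C = n"
    using carrier_matD[OF Qc] carrier_matD[OF Cc] by simp_all
  \<comment> \<open>The product over \<open>h < j\<close> contains the vanishing factor
    \<open>h = i\<close>.\<close>
  have C_lower: "C $$ (i, j) = 0" if "i < j" "j < n" for i j
    using that by (auto simp: C_def)
  have CL: "diag_of n t * C = C * ?L"
  proof (rule eq_matI)
    fix i j assume "i < dim_row (C * ?L)" "j < dim_col (C * ?L)"
    then have ij: "i < n" "j < n" by (simp_all add: C_def)
    \<comment> \<open>For \<open>j = n - 1\<close> the product runs over all indices and again
      contains the factor \<open>h = i\<close>, so no column \<open>n\<close> is missing.\<close>
    have last: "B' $$ (i, 0) * (\<Prod>h<Suc j. t i - t h) = (if j + 1 < n then C $$ (i, j + 1) else 0)"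
    proof (cases "Suc j < n")
      case True
      then show ?thesis using ij by (simp add: C_def del: prod.lessThan_Suc)
    next
      case False
      then have "Suc j = n" using ij by simp
      then have "(\<Prod>h<Suc j. t i - t h) = 0" using ij by (intro prod_zero) auto
      then show ?thesis using False by (simp del: prod.lessThan_Suc)
    qed
    have "t i * C $$ (i, j) - C $$ (i, j) * t j = B' $$ (i, 0) * (\<Prod>h<Suc j. t i - t h)"
      using ij by (simp add: C_def algebra_simps)
    then have "t i * C $$ (i, j) = C $$ (i, j) * t j + (if j + 1 < n then C $$ (i, j + 1) else 0)"
      unfolding last by (simp add: diff_eq_eq add.commute)
    then show "(diag_of n t * C) $$ (i, j) = (C * ?L) $$ (i, j)"
      unfolding diag_of_mult_entry[OF Cc ij] mult_lower_bidiag_entry[OF Cc ij]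
      by (simp only: mult_1_right)
  qed (simp_all add: C_def)
  have XQ: "X * Q = Q * ?L"
  proof -
    have "X * Q = B * (diag_of n t * (B' * (B * C)))"
      by (simp add: X(1) Q_def assoc)
    also have "\<dots> = B * (diag_of n t * C)"
      by (simp add: mutual_inverse_cancel(2)[OF B Cc])
    also have "\<dots> = Q * ?L" by (simp add: CL Q_def assoc)
    finally show ?thesis .
  qed
  \<comment> \<open>Column 0 of \<open>C\<close> is column 0 of \<open>B'\<close>, so column 0 of
    \<open>Q\<close> is that of \<open>B * B'\<close>, a unit vector.\<close>
  have Q0: "Q $$ (i, 0) = (if i = 0 then 1 else 0)" if "i < n" for i
  proof -
    have "Q $$ (i, 0) = (B * B') $$ (i, 0)"
      unfolding Q_def mult_mat_entry[OF Bc(1) Cc that n] mult_mat_entry[OF Bc that n]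
      by (rule sum.cong) (use n in \<open>auto simp: C_def\<close>)
    then show ?thesis using inv that n by simp
  qed
  \<comment> \<open>Column \<open>j\<close> of \<open>X * Q = Q * ?L\<close>, solved for the next
    column: it is \<open>X - t j\<close> applied to column \<open>j\<close>.\<close>
  have Q_step: "Q $$ (i, Suc j) = (\<Sum>k<n. X $$ (i, k) * Q $$ (k, j)) - t j * Q $$ (i, j)"
    if "i < n" "Suc j < n" for i j
  proof -
    have "(X * Q) $$ (i, j) = Q $$ (i, j) * t j + Q $$ (i, Suc j)"
      unfolding XQ using that by (subst mult_lower_bidiag_entry[of _ n]) auto
    then show ?thesis using that by (simp add: mult_mat_entry[OF Xc Qc] del: index_mult_mat(1))
  qed
  \<comment> \<open>Each application of \<open>X\<close> pushes the support down by at most one row,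
    and the new lowest entry is the old one times the nonzero
    \<open>X $$ (Suc j, j)\<close>.\<close>
  have Q_cols: "(\<forall>i<n. j < i \<longrightarrow> Q $$ (i, j) = 0) \<and> Q $$ (j, j) \<noteq> 0" if "j < n" for j
    using that
  proof (induction j)
    case 0
    then show ?case using Q0 by auto
  next
    case (Suc j)
    have IH: "\<And>i. i < n \<Longrightarrow> j < i \<Longrightarrow> Q $$ (i, j) = 0" "Q $$ (j, j) \<noteq> 0"
      using Suc by auto
    have tri: "(\<Sum>k<n. X $$ (i, k) * Q $$ (k, j)) = (if i = Suc j then X $$ (i, j) * Q $$ (j, j) else 0)"
      if "i < n" "Suc j \<le> i" for i
    proof -
      have "X $$ (i, k) * Q $$ (k, j) = (if k = j then if i = Suc j then X $$ (i, j) * Q $$ (j, j) else 0 else 0)"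
        if "k < n" for k
      proof -
        consider "j < k" | "k = j" "i = Suc j" | "k = j" "Suc j < i" | "k < j" using \<open>Suc j \<le> i\<close> by linarith
        then show ?thesis
          using X(2) IH(1) \<open>i < n\<close> \<open>Suc j \<le> i\<close> that by cases (auto simp: irred_tridiag_def)
      qed
      then have "(\<Sum>k<n. X $$ (i, k) * Q $$ (k, j)) =
        (\<Sum>k<n. if k = j then if i = Suc j then X $$ (i, j) * Q $$ (j, j) else 0 else 0)"
        by (intro sum.cong) auto
      then show ?thesis using Suc.prems by simp
    qed
    have "X $$ (Suc j, j) \<noteq> 0" using X(2) Suc.prems by (auto simp: irred_tridiag_def)
    then show ?case using Suc.prems IH by (auto simp: Q_step tri)
  qed
  have Q_upper: "Q $$ (i, j) = 0" if "j < i" "i < n" for i j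
    using Q_cols[of j] that by simp
  have Q_diag: "Q $$ (i, i) \<noteq> 0" if "i < n" for i
    using Q_cols[of i] that by simp
  have "det Q = prod_list (diag_mat Q)"
    using Q_upper Qc by (intro det_upper_triangular[of _ n]) (auto simp: upper_triangular_def)
  then have detQ: "det Q \<noteq> 0" using Q_diag Qc by (auto simp: diag_mat_def prod_list_zero_iff)
  \<comment> \<open>\<open>det Q = det B * det C\<close>; this is what later makes every diagonal
    entry of \<open>C\<close> nonzero.\<close>
  then have detC: "det C \<noteq> 0" using det_mult[OF Bc(1) Cc] by (auto simp: Q_def)
  obtain Q' where Q': "mutual_inverse n Q Q'" using mutual_inverse_of_det[OF Qc detQ] .
  then have Q'c [simp]: "Q' \<in> carrier_mat n n" by (simp add: mutual_inverse_def)
  \<comment> \<open>The second operator in the basis of columns of \<open>Q\<close>. It is squeezed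
    from two sides: \<open>Q * N = diag_of n ts * Q\<close> with \<open>Q\<close> upper triangular
    clears everything below the diagonal, and \<open>C * N = Y * C\<close> with \<open>C\<close>
    lower triangular clears everything beyond the superdiagonal.\<close>
  define N where "N = Q' * (diag_of n ts * Q)"
  have Nc [simp]: "N \<in> carrier_mat n n" by (auto simp: N_def intro!: mult_carrier_mat[of _ n n])
  have QN: "Q * N = diag_of n ts * Q"
    unfolding N_def by (rule mutual_inverse_cancel(1)[OF Q', of _ n]) (auto intro!: mult_carrier_mat[of _ n n])
  have CN: "C * N = Y * C"
  proof -
    have CB: "C = B' * Q" unfolding Q_def using mutual_inverse_cancel(2)[OF B Cc] by simp
    have "C * N = B' * (Q * N)" by (subst CB) (simp add: assoc)
    also have "\<dots> = B' * (diag_of n ts * Q)" by (simp only: QN)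
    also have "\<dots> = Y * C" by (simp add: Y(1) Q_def assoc)
    finally show ?thesis .
  qed
  have QN': "(Q * N) $$ (i, j) = ts i * Q $$ (i, j)" if "i < n" "j < n" for i j
    unfolding QN using that by (simp add: diag_of_mult_entry[OF Qc] del: index_mult_mat(1))
  have N_upper: "N $$ (i, j) = 0" if "j < i" "i < n" for i j
    using that
  proof (induction "n - i" arbitrary: i rule: less_induct)
    case less
    have "N $$ (k, j) = 0" if "i < k" "k < n" for k
      using less.prems that by (intro less.hyps) auto
    then have "(Q * N) $$ (i, j) = Q $$ (i, i) * N $$ (i, j)"
      using less.prems Q_upper by (intro upper_triangular_mult_entry[OF Qc _ Nc]) auto
    then show ?case using QN'[of i j] Q_upper[of j i] Q_diag[of i] less.prems by auto
  qed
  have N_diag: "N $$ (i, i) = ts i" if "i < n" for i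
  proof -
    have "(Q * N) $$ (i, i) = Q $$ (i, i) * N $$ (i, i)"
      using that Q_upper N_upper by (intro upper_triangular_mult_entry[OF Qc _ Nc]) auto
    then show ?thesis using QN'[of i i] Q_diag[of i] that by auto
  qed
  have C_diag: "C $$ (i, i) \<noteq> 0" if "i < n" for i
  proof
    assume z: "C $$ (i, i) = 0"
    have "det C = prod_list (diag_mat C)"
      using C_lower by (intro det_lower_triangular[of n]) auto
    then show False using z that detC by (auto simp: diag_mat_def prod_list_zero_iff)
  qed
  \<comment> \<open>\<open>C $$ (k, j)\<close> vanishes for \<open>k < j\<close>, and every other
    \<open>k\<close> lies more than one step to the right of \<open>i\<close>, out of reach of
    \<open>Y\<close>.\<close>
  have YC_far: "(Y * C) $$ (i, j) = 0" if "i + 1 < j" "j < n" for i j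
  proof -
    have "Y $$ (i, k) * C $$ (k, j) = 0" if "k < n" for k
    proof (cases "k < j")
      case True
      then show ?thesis using C_lower[of k j] \<open>j < n\<close> by simp
    next
      case False
      then have "\<bar>int i - int k\<bar> > 1" using \<open>i + 1 < j\<close> by linarith
      then show ?thesis using Y(2) that \<open>i + 1 < j\<close> \<open>j < n\<close> by (auto simp: irred_tridiag_def)
    qed
    then have "(\<Sum>k<n. Y $$ (i, k) * C $$ (k, j)) = 0" by (intro sum.neutral) auto
    then show ?thesis using that
      by (simp add: mult_mat_entry[OF Yc Cc] del: index_mult_mat(1))
  qed
  have YC_near: "(Y * C) $$ (i, i + 1) = Y $$ (i, i + 1) * C $$ (i + 1, i + 1)" if "i + 1 < n" for i
  proof -
    have "(Y * C) $$ (i, i + 1) =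
      (\<Sum>k<n. if k = i + 1 then Y $$ (i, i + 1) * C $$ (i + 1, i + 1) else 0)"
    proof (subst mult_mat_entry[OF Yc Cc])
      show "(\<Sum>k<n. Y $$ (i, k) * C $$ (k, i + 1)) =
        (\<Sum>k<n. if k = i + 1 then Y $$ (i, i + 1) * C $$ (i + 1, i + 1) else 0)"
      proof (rule sum.cong)
        fix k assume k: "k \<in> {..<n}"
        consider "k < i + 1" | "k = i + 1" | "i + 1 < k" by linarith
        then show "Y $$ (i, k) * C $$ (k, i + 1) =
            (if k = i + 1 then Y $$ (i, i + 1) * C $$ (i + 1, i + 1) else 0)"
          using C_lower[of k "i + 1"] Y(2) k that by cases (auto simp: irred_tridiag_def)
      qed simp
    qed (use that in auto)
    then show ?thesis using that by simp
  qed
  have N_far: "N $$ (i, j) = 0" if "i + 1 < j" "j < n" for i j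
    using that
  proof (induction i rule: less_induct)
    case (less i)
    have "(C * N) $$ (i, j) = C $$ (i, i) * N $$ (i, j)"
      using less C_lower by (intro lower_triangular_mult_entry[OF Cc _ Nc]) auto
    then show ?case using YC_far[OF less.prems] C_diag[of i] less.prems by (auto simp: CN)
  qed
  \<comment> \<open>On the superdiagonal \<open>C * N = Y * C\<close> reads \<open>C $$ (i, i) * N
    $$ (i, i + 1) = Y $$ (i, i + 1) * C $$ (i + 1, i + 1)\<close>, and the right side is
    nonzero.\<close>
  have N_super: "N $$ (i, i + 1) \<noteq> 0" if "i + 1 < n" for i
  proof -
    have "(C * N) $$ (i, i + 1) = C $$ (i, i) * N $$ (i, i + 1)"
      using that N_far C_lower by (intro lower_triangular_mult_entry[OF Cc _ Nc]) auto
    moreover have "Y $$ (i, i + 1) \<noteq> 0" using Y(2) that by (auto simp: irred_tridiag_def)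
    ultimately show ?thesis using YC_near[OF that] C_diag[of "i + 1"] that by (auto simp: CN)
  qed
  define vp where "vp j = N $$ (j - 1, j)" for j
  have N_eq: "N = upper_bidiag n ts vp"
  proof (rule eq_matI)
    fix i j assume "i < dim_row (upper_bidiag n ts vp)" "j < dim_col (upper_bidiag n ts vp)"
    then have ij: "i < n" "j < n" by auto
    consider "j < i" | "j = i" | "j = i + 1" | "i + 1 < j" by linarith
    then show "N $$ (i, j) = upper_bidiag n ts vp $$ (i, j)"
      using ij N_upper N_diag N_far by cases (auto simp: upper_bidiag_def vp_def)
  qed (use carrier_matD[OF Nc] in simp_all)
  show thesis
  proof (rule that[OF Q' _ _ _ Cc detC CL])
    show "Q' * (X * Q) = ?L"
      unfolding XQ using mutual_inverse_cancel(2)[OF Q', of ?L n] by simp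
    show "Q' * (diag_of n ts * Q) = upper_bidiag n ts vp" using N_eq by (simp add: N_def)
    show "C * upper_bidiag n ts vp = Y * C" using CN by (simp add: N_eq)
    show "vp i \<noteq> 0" if "0 < i" "i < n" for i
      using N_super[of "i - 1"] that by (simp add: vp_def)
  qed
qed

section \<open>Uniqueness of the split form\<close>

lemma algebra_isoD:
  assumes "algebra_iso M N f"
  shows "\<And>x. x \<in> carrier M \<Longrightarrow> f x \<in> carrier N"
    "\<And>x y. x \<in> carrier M \<Longrightarrow> y \<in> carrier M \<Longrightarrow> f (x \<otimes>\<^bsub>M\<^esub> y) = f x \<otimes>\<^bsub>N\<^esub> f y"
    "\<And>x y. x \<in> carrier M \<Longrightarrow> y \<in> carrier M \<Longrightarrow> f (x \<oplus>\<^bsub>M\<^esub> y) = f x \<oplus>\<^bsub>N\<^esub> f y"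
    "f \<one>\<^bsub>M\<^esub> = \<one>\<^bsub>N\<^esub>"
    "\<And>c x. x \<in> carrier M \<Longrightarrow> f (c \<odot>\<^bsub>M\<^esub> x) = c \<odot>\<^bsub>N\<^esub> f x"
    "bij_betw f (carrier M) (carrier N)"
  using assms by (auto simp: algebra_iso_def ring_iso_def Ring.ring_hom_def)

lemma algebra_isoI:
  assumes "\<And>x. x \<in> carrier M \<Longrightarrow> f x \<in> carrier N"
    "\<And>x y. x \<in> carrier M \<Longrightarrow> y \<in> carrier M \<Longrightarrow> f (x \<otimes>\<^bsub>M\<^esub> y) = f x \<otimes>\<^bsub>N\<^esub> f y"
    "\<And>x y. x \<in> carrier M \<Longrightarrow> y \<in> carrier M \<Longrightarrow> f (x \<oplus>\<^bsub>M\<^esub> y) = f x \<oplus>\<^bsub>N\<^esub> f y"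
    "f \<one>\<^bsub>M\<^esub> = \<one>\<^bsub>N\<^esub>"
    "\<And>c x. x \<in> carrier M \<Longrightarrow> f (c \<odot>\<^bsub>M\<^esub> x) = c \<odot>\<^bsub>N\<^esub> f x"
    "bij_betw f (carrier M) (carrier N)"
  shows "algebra_iso M N f"
  using assms by (auto simp: algebra_iso_def ring_iso_def Ring.ring_hom_def)

lemma algebra_iso_comp:
  assumes f: "algebra_iso M N f" and g: "algebra_iso N K g"
  shows "algebra_iso M K (g \<circ> f)"
  using algebra_isoD[OF f] algebra_isoD[OF g]
  by (intro algebra_isoI) (simp_all add: bij_betw_trans)

lemma algebra_iso_inv:
  assumes M: "assoc_algebra M" and f: "algebra_iso M N f"
  shows "algebra_iso N M (inv_into (carrier M) f)"
proof -
  interpret ring M using M by (simp add: assoc_algebra_def)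
  interpret Module.module class_ring M using M by (simp add: assoc_algebra_def)
  let ?g = "inv_into (carrier M) f"
  have bij: "bij_betw f (carrier M) (carrier N)" by (rule algebra_isoD(6)[OF f])
  have g: "\<And>y. y \<in> carrier N \<Longrightarrow> ?g y \<in> carrier M" "\<And>y. y \<in> carrier N \<Longrightarrow> f (?g y) = y"
    using bij by (auto simp: bij_betw_def inv_into_into f_inv_into_f)
  have eq: "?g y = x" if "x \<in> carrier M" "y = f x" for x y
    using that bij by (auto simp: bij_betw_def)
  have smult: "c \<odot>\<^bsub>M\<^esub> x \<in> carrier M" if "x \<in> carrier M" for c x
    using that by (simp add: smult_closed)
  show ?thesis
    by (rule algebra_isoI) (auto simp: g algebra_isoD[OF f] smult bij_betw_inv_into[OF bij] intro!: eq)
qed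

text \<open>A change of basis is an inner automorphism composed with a given isomorphism; every new
  matrix form below is produced this way.\<close>

lemma algebra_iso_conj:
  assumes P: "mutual_inverse n P P'" and f: "algebra_iso M (mat_algebra n) f"
  shows "algebra_iso M (mat_algebra n) (\<lambda>x. P * (f x * P'))"
proof -
  note assoc = assoc_mult_mat[of _ n n _ n _ n] mult_carrier_mat[of _ n n _ n]
  note closed = mult_carrier_mat[of _ n n _ n]
  have c [simp]: "P \<in> carrier_mat n n" "P' \<in> carrier_mat n n" and one: "P * P' = 1\<^sub>m n"
    using P by (auto simp: mutual_inverse_def)
  note cancel = mutual_inverse_cancel[OF P, of _ n]
  have *: "P * (P' * (Z * P) * P') = Z" "P' * (P * (Z * P') * P) = Z" if "Z \<in> carrier_mat n n" for Z
    using that P unfolding mutual_inverse_def by (simp_all add: assoc closed cancel)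
  have "algebra_iso (mat_algebra n) (mat_algebra n) (\<lambda>Z. P * (Z * P'))"
  proof (rule algebra_isoI; simp add: module_mat_simps)
    show "P * (1\<^sub>m n * P') = 1\<^sub>m n" using one left_mult_one_mat[OF c(2)] by simp
    show "bij_betw (\<lambda>Z. P * (Z * P')) (carrier_mat n n) (carrier_mat n n)"
      by (rule bij_betw_byWitness[where f' = "\<lambda>Z. P' * (Z * P)"]) (auto simp: * intro!: closed)
    fix x y :: "'a mat" and k :: 'a assume [simp]: "x \<in> carrier_mat n n"
    show "P * (x * P') \<in> carrier_mat n n" by (auto intro!: closed)
    show "P * (k \<cdot>\<^sub>m x * P') = k \<cdot>\<^sub>m (P * (x * P'))"
      by (simp add: mult_smult_assoc_mat[of _ n n _ n] mult_smult_distrib[of _ n n _ n] closed)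
    assume [simp]: "y \<in> carrier_mat n n"
    show "P * (x * y * P') = P * (x * P') * (P * (y * P'))"
      by (simp add: assoc closed cancel)
    show "P * ((x + y) * P') = P * (x * P') + P * (y * P')"
      by (simp add: add_mult_distrib_mat[of _ n n _ _ n] mult_add_distrib_mat[of _ n n _ n] closed)
  qed
  from algebra_iso_comp[OF f this] show ?thesis by (simp add: o_def)
qed

text \<open>The intertwining half of the Skolem--Noether theorem: if column \<open>c\<close> of \<open>\<alpha> E\<^sub>0\<^sub>0\<close> does not vanish,
  then the columns number \<open>c\<close> of \<open>\<alpha> E\<^sub>0\<^sub>0, \<alpha> E\<^sub>1\<^sub>0, \<dots>\<close> make up an intertwiner.\<close>

lemma matrix_algebra_automorphism_intertwiner:
  fixes \<alpha> :: "'k::field mat \<Rightarrow> 'k mat"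
  assumes n: "0 < n" and \<alpha>: "algebra_iso (mat_algebra n) (mat_algebra n) \<alpha>"
  obtains S where "S \<in> carrier_mat n n" "S \<noteq> 0\<^sub>m n n"
    "\<And>Z. Z \<in> carrier_mat n n \<Longrightarrow> \<alpha> Z * S = S * Z"
proof -
  \<comment> \<open>Matrix units of column 0. \<open>Z * E i\<close> is column \<open>i\<close> of
    \<open>Z\<close> moved to column 0, hence the combination of the \<open>E k\<close> with
    coefficients \<open>Z $$ (k, i)\<close>.\<close>
  define E where "E i = mat n n (\<lambda>(a, b). if a = i \<and> b = 0 then 1 else 0 :: 'k)" for i
  note iso = algebra_isoD[OF \<alpha>, unfolded module_mat_simps]
  have Ec [simp]: "E i \<in> carrier_mat n n" for i by (simp add: E_def)
  have zero: "\<alpha> (0\<^sub>m n n) = 0\<^sub>m n n"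
  proof -
    have "\<alpha> (0 \<cdot>\<^sub>m 0\<^sub>m n n) = 0 \<cdot>\<^sub>m \<alpha> (0\<^sub>m n n)" by (rule iso(5)) simp
    moreover have "0 \<cdot>\<^sub>m Z = 0\<^sub>m n n" if "Z \<in> carrier_mat n n" for Z :: "'k mat"
      using that by auto
    ultimately show ?thesis using iso(1)[of "0\<^sub>m n n"] by simp
  qed
  have "E 0 $$ (0, 0) = 1" using n by (simp add: E_def)
  then have "E 0 \<noteq> 0\<^sub>m n n" using n by (metis index_zero_mat(1) zero_neq_one)
  then have "\<alpha> (E 0) \<noteq> 0\<^sub>m n n"
    using iso(6) zero by (auto simp: bij_betw_def inj_on_def)
  then obtain a c where ac: "a < n" "c < n" "\<alpha> (E 0) $$ (a, c) \<noteq> 0"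
    using iso(1)[OF Ec] by (metis carrier_matD eq_matI index_zero_mat)
  define S where "S = mat n n (\<lambda>(a, i). \<alpha> (E i) $$ (a, c))"
  have Sc: "S \<in> carrier_mat n n" by (simp add: S_def)
  have "S $$ (a, 0) \<noteq> 0" using ac n by (simp add: S_def)
  then have S0: "S \<noteq> 0\<^sub>m n n" using ac n by auto
  have "\<alpha> Z * S = S * Z" if Z: "Z \<in> carrier_mat n n" for Z
  proof (rule eq_matI)
    fix a i assume "a < dim_row (S * Z)" "i < dim_col (S * Z)"
    then have ai: "a < n" "i < n" using Sc Z by auto
    have "(\<alpha> Z * S) $$ (a, i) = (\<alpha> Z * \<alpha> (E i)) $$ (a, c)"
      unfolding mult_mat_entry[OF iso(1)[OF Z] Sc ai] mult_mat_entry[OF iso(1)[OF Z] iso(1)[OF Ec] ai(1) ac(2)]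
      by (rule sum.cong) (use ai in \<open>auto simp: S_def\<close>)
    also have "\<dots> = \<alpha> (Z * E i) $$ (a, c)" by (simp add: iso(2) Z)
    also have "\<dots> = (\<Sum>k<n. S $$ (a, k) * Z $$ (k, i))"
    proof -
      \<comment> \<open>The partial sums of that combination, so that linearity of
        \<open>\<alpha>\<close> can be applied one summand at a time.\<close>
      define W where "W m = mat n n (\<lambda>(a, b). if b = 0 \<and> a < m then Z $$ (a, i) else 0)" for m
      have Wc: "W m \<in> carrier_mat n n" for m by (simp add: W_def)
      have "\<alpha> (W m) $$ (a, c) = (\<Sum>k<m. S $$ (a, k) * Z $$ (k, i))" if "m \<le> n" for m
        using that
      proof (induction m)
        case 0
        have "W 0 = 0\<^sub>m n n" by (auto simp: W_def)
        then show ?case using zero ai ac by simp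
      next
        case (Suc m)
        have "W (Suc m) = W m + Z $$ (m, i) \<cdot>\<^sub>m E m"
          by (rule eq_matI) (auto simp: W_def E_def less_Suc_eq)
        then have "\<alpha> (W (Suc m)) = \<alpha> (W m) + Z $$ (m, i) \<cdot>\<^sub>m \<alpha> (E m)"
          by (simp add: iso(3,5) Wc)
        then show ?case using Suc ai ac iso(1)[OF Ec, of m] by (simp add: S_def mult.commute)
      qed
      moreover have "Z * E i = W n"
      proof (rule eq_matI)
        fix a b assume "a < dim_row (W n)" "b < dim_col (W n)"
        then have ab: "a < n" "b < n" by (auto simp: W_def)
        have "(Z * E i) $$ (a, b) = (\<Sum>k<n. if k = i then if b = 0 then Z $$ (a, i) else 0 else 0)"
          unfolding mult_mat_entry[OF Z Ec ab] by (rule sum.cong) (use ab in \<open>auto simp: E_def\<close>)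
        then show "(Z * E i) $$ (a, b) = W n $$ (a, b)" using ab ai by (simp add: W_def)
      qed (use Z in \<open>auto simp: W_def E_def\<close>)
      ultimately show ?thesis by simp
    qed
    also have "\<dots> = (S * Z) $$ (a, i)" by (rule mult_mat_entry[OF Sc Z ai, symmetric])
    finally show "(\<alpha> Z * S) $$ (a, i) = (S * Z) $$ (a, i)" .
  qed (use iso(1)[OF Z] Sc Z in auto)
  then show thesis using that Sc S0 by blast
qed

text \<open>The upper bidiagonal relation puts column 0 of the intertwiner \<open>S\<close> into the
  eigenspace for \<open>ts 0\<close>, which is spanned by the first unit vector because
  \<open>ts 0\<close> is not repeated. The lower bidiagonal relation then produces each column from
  the previous one, so \<open>S\<close> is a nonzero scalar and the superdiagonals agree.\<close>

lemma bidiag_pair_unique: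
  fixes \<alpha> :: "'k::field mat \<Rightarrow> 'k mat"
  assumes n: "0 < n" and \<alpha>: "algebra_iso (mat_algebra n) (mat_algebra n) \<alpha>"
    and L: "\<alpha> (lower_bidiag n t (\<lambda>_. 1)) = lower_bidiag n t (\<lambda>_. 1)"
    and U: "\<alpha> (upper_bidiag n ts v) = upper_bidiag n ts w"
    and ts: "\<And>i. 0 < i \<Longrightarrow> i < n \<Longrightarrow> ts i \<noteq> ts 0" and i: "0 < i" "i < n"
  shows "v i = w i"
proof -
  obtain S where S: "S \<in> carrier_mat n n" "S \<noteq> 0\<^sub>m n n"
    and \<alpha>S: "\<And>Z. Z \<in> carrier_mat n n \<Longrightarrow> \<alpha> Z * S = S * Z"
    using matrix_algebra_automorphism_intertwiner[OF n \<alpha>] by blast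
  have LS: "t i * S $$ (i, j) + (if 0 < i then S $$ (i - 1, j) else 0) =
      S $$ (i, j) * t j + (if j + 1 < n then S $$ (i, j + 1) else 0)" if "i < n" "j < n" for i j
  proof -
    have "(lower_bidiag n t (\<lambda>_. 1) * S) $$ (i, j) = (S * lower_bidiag n t (\<lambda>_. 1)) $$ (i, j)"
      using \<alpha>S[of "lower_bidiag n t (\<lambda>_. 1)"] by (simp only: L bidiag_carrier)
    then show ?thesis
      unfolding lower_bidiag_mult_entry[OF S(1) that] mult_lower_bidiag_entry[OF S(1) that]
      by (simp only: mult_1_left mult_1_right)
  qed
  have US: "ts i * S $$ (i, j) + (if i + 1 < n then w (i + 1) * S $$ (i + 1, j) else 0) =
      S $$ (i, j) * ts j + (if 0 < j then S $$ (i, j - 1) * v j else 0)" if "i < n" "j < n" for i j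
  proof -
    have "(upper_bidiag n ts w * S) $$ (i, j) = (S * upper_bidiag n ts v) $$ (i, j)"
      using \<alpha>S[of "upper_bidiag n ts v"] by (simp only: U bidiag_carrier)
    then show ?thesis
      unfolding upper_bidiag_mult_entry[OF S(1) that] mult_upper_bidiag_entry[OF S(1) that]
      by (simp only: mult_1_left mult_1_right)
  qed
  \<comment> \<open>From the bottom row up: once the entry below is zero, \<open>US\<close> in
    column 0 leaves \<open>ts i * S $$ (i, 0) = S $$ (i, 0) * ts 0\<close>.\<close>
  have col0: "S $$ (i, 0) = 0" if "0 < i" "i < n" for i
    using that
  proof (induction "n - i" arbitrary: i rule: less_induct)
    case less
    have "S $$ (i + 1, 0) = 0" if "i + 1 < n"
      using less.prems that by (intro less.hyps) auto
    then show ?case using US[of i 0] ts[OF less.prems] less.prems by (auto split: if_splits)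
  qed
  define c where "c = S $$ (0, 0)"
  have scalar: "\<forall>i<n. S $$ (i, j) = (if i = j then c else 0)" if "j < n" for j
    using that
  proof (induction j)
    case 0
    then show ?case using col0 by (auto simp: c_def)
  next
    case (Suc j)
    show ?case
    proof (intro allI impI)
      fix i assume i: "i < n"
      have IH: "S $$ (k, j) = (if k = j then c else 0)" if "k < n" for k
        using Suc that by simp
      \<comment> \<open>\<open>LS\<close> solved for column \<open>Suc j\<close>. The factor
        \<open>t i - t j\<close> vanishes in the only row where column \<open>j\<close> can be
        nonzero.\<close>
      have "S $$ (i, Suc j) = (t i - t j) * S $$ (i, j) + (if 0 < i then S $$ (i - 1, j) else 0)"
        using LS[OF i, of j] Suc.prems by (simp add: algebra_simps)
      also have "\<dots> = (if i = Suc j then c else 0)"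
        using IH[OF i] IH[of "i - 1"] i by auto
      finally show "S $$ (i, Suc j) = (if i = Suc j then c else 0)" .
    qed
  qed
  have "c \<noteq> 0"
  proof
    assume "c = 0"
    then have "S = 0\<^sub>m n n" using scalar S(1) by (intro eq_matI) auto
    then show False using S(2) by simp
  qed
  \<comment> \<open>Entry \<open>(i - 1, i)\<close> of \<open>US\<close> now reads
    \<open>w i * c = c * v i\<close>.\<close>
  moreover have "i - 1 < n" "i - 1 \<noteq> i" "i - 1 + 1 = i" using i by auto
  ultimately show ?thesis
    using US[of "i - 1" i] scalar[of i] scalar[of "i - 1"] i by (simp add: mult.commute)
qed

section \<open>The sequence of a split form; rescaling and reversal\<close>

lemma split_form_bidiag:
  "split_form d M \<Phi> f vp \<longleftrightarrow> algebra_iso M (mat_algebra (d + 1)) f \<and>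
     f (elt \<Phi>) = lower_bidiag (d + 1) (eigenvalue_seq M \<Phi>) (\<lambda>_. 1) \<and>
     f (dual_elt \<Phi>) = upper_bidiag (d + 1) (dual_eigenvalue_seq M \<Phi>) vp"
  by (simp add: split_form_def lower_bidiag_def upper_bidiag_def)

text \<open>Two split forms differ by an automorphism of the matrix algebra that fixes the lower
  bidiagonal matrix, so uniqueness for bidiagonal pairs lets any split form at hand compute the
  sequence.\<close>

lemma varphi_seq_eqI:
  assumes M: "assoc_algebra M" and vp: "split_form d M \<Phi> f vp"
    and ts: "\<And>i. 0 < i \<Longrightarrow> i \<le> d \<Longrightarrow> dual_eigenvalue_seq M \<Phi> i \<noteq> dual_eigenvalue_seq M \<Phi> 0"
    and el: "elt \<Phi> \<in> carrier M" "dual_elt \<Phi> \<in> carrier M" and i: "i \<in> {1..d}"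
  shows "varphi_seq d M \<Phi> i = vp i"
proof -
  have unique: "v j = w j"
    if v: "split_form d M \<Phi> g v" and w: "split_form d M \<Phi> h w" and j: "j \<in> {1..d}" for g h v w j
  proof -
    have g: "algebra_iso M (mat_algebra (d + 1)) g" and h: "algebra_iso M (mat_algebra (d + 1)) h"
      using v w by (simp_all add: split_form_def)
    let ?\<alpha> = "h \<circ> inv_into (carrier M) g"
    have inj: "inj_on g (carrier M)" using algebra_isoD(6)[OF g] by (simp add: bij_betw_def)
    have \<alpha>: "?\<alpha> (g x) = h x" if "x \<in> carrier M" for x
      using inj that by simp
    have "algebra_iso (mat_algebra (d + 1)) (mat_algebra (d + 1)) ?\<alpha>"
      by (rule algebra_iso_comp[OF algebra_iso_inv[OF M g] h])
    then show ?thesis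
    proof (rule bidiag_pair_unique[rotated])
      show "?\<alpha> (lower_bidiag (d + 1) (eigenvalue_seq M \<Phi>) (\<lambda>_. 1)) =
          lower_bidiag (d + 1) (eigenvalue_seq M \<Phi>) (\<lambda>_. 1)"
        using \<alpha>[OF el(1)] v w by (simp add: split_form_bidiag)
      show "?\<alpha> (upper_bidiag (d + 1) (dual_eigenvalue_seq M \<Phi>) v) =
          upper_bidiag (d + 1) (dual_eigenvalue_seq M \<Phi>) w"
        using \<alpha>[OF el(2)] v w by (simp add: split_form_bidiag)
    qed (use ts j in auto)
  qed
  \<comment> \<open>The definite description ranges over extensional functions, so \<open>vp\<close>
    is cut down to the indices that occur in the matrix.\<close>
  let ?v = "restrict vp {1..d}"
  have "upper_bidiag (d + 1) s vp = upper_bidiag (d + 1) s ?v" for s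
    by (auto simp: upper_bidiag_def intro!: eq_matI)
  then have v: "split_form d M \<Phi> f ?v" using vp by (simp add: split_form_bidiag)
  have "varphi_seq d M \<Phi> = ?v"
    unfolding varphi_seq_def
  proof (rule the_equality)
    show "?v \<in> extensional {1..d} \<and> (\<exists>f. split_form d M \<Phi> f ?v)" using v by blast
    fix w assume "w \<in> extensional {1..d} \<and> (\<exists>f. split_form d M \<Phi> f w)"
    then obtain h where w: "w \<in> extensional {1..d}" "split_form d M \<Phi> h w" by blast
    show "w = ?v"
      by (rule extensionalityI[OF w(1) restrict_extensional]) (rule unique[OF w(2) v])
  qed
  then show ?thesis using i by simp
qed

text \<open>Conjugation by a diagonal matrix multiplies entry \<open>(i, j)\<close> by
  \<open>a i / a j\<close>, which can move the weights from one off-diagonal to the other. A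
  transposed or reversed split form thereby acquires the normalization of a split form with the two
  elements exchanged.\<close>

lemma bidiag_pair_rescale:
  assumes f: "algebra_iso M (mat_algebra n) f"
    and x: "f x = upper_bidiag n t (\<lambda>_. 1)" and y: "f y = lower_bidiag n s v"
    and v: "\<And>i. 0 < i \<Longrightarrow> i < n \<Longrightarrow> v i \<noteq> 0"
  obtains g where "algebra_iso M (mat_algebra n) g"
    "g x = upper_bidiag n t v" "g y = lower_bidiag n s (\<lambda>_. 1)"
proof
  \<comment> \<open>Chosen with \<open>a i = a (i - 1) / v i\<close>: the subdiagonal
    \<open>v i\<close> becomes 1 and the superdiagonal 1 becomes \<open>v i\<close>.\<close>
  define a where "a i = (\<Prod>h\<in>{1..i}. inverse (v h))" for i
  have a: "a i \<noteq> 0" if "i < n" for i using that v by (auto simp: a_def)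
  have a_Suc: "a (Suc i) = a i * inverse (v (Suc i))" for i by (simp add: a_def)
  let ?g = "\<lambda>z. diag_of n a * (f z * diag_of n (\<lambda>i. inverse (a i)))"
  show "algebra_iso M (mat_algebra n) ?g"
    by (rule algebra_iso_conj[OF mutual_inverse_diag f]) (rule a)
  have entry: "(diag_of n a * (Z * diag_of n (\<lambda>i. inverse (a i)))) $$ (i, j) =
      a i * Z $$ (i, j) * inverse (a j)" if "Z \<in> carrier_mat n n" "i < n" "j < n" for Z i j
    using that
    by (simp add: diag_of_mult_entry[of _ n n] mult_diag_of_entry[of _ n n] mult_carrier_mat[of _ n n]
        del: index_mult_mat(1))
  show "?g x = upper_bidiag n t v"
  proof (rule eq_matI)
    fix i j assume "i < dim_row (upper_bidiag n t v)" "j < dim_col (upper_bidiag n t v)"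
    then have ij: "i < n" "j < n" by simp_all
    show "?g x $$ (i, j) = upper_bidiag n t v $$ (i, j)"
      unfolding x entry[OF bidiag_carrier(3) ij]
      using ij a[of i] a[of j] v[of j] by (auto simp: upper_bidiag_def a_Suc)
  qed simp_all
  show "?g y = lower_bidiag n s (\<lambda>_. 1)"
  proof (rule eq_matI)
    fix i j assume "i < dim_row (lower_bidiag n s (\<lambda>_. 1))" "j < dim_col (lower_bidiag n s (\<lambda>_. 1))"
    then have ij: "i < n" "j < n" by simp_all
    show "?g y $$ (i, j) = lower_bidiag n s (\<lambda>_. 1) $$ (i, j)"
      unfolding y entry[OF bidiag_carrier(2) ij]
      using ij a[of i] a[of j] v[of i] by (auto simp: lower_bidiag_def a_Suc field_simps)
  qed simp_all
qed

text \<open>Conjugation by the permutation matrix that reverses the basis, which is its own inverse.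
  Upper and lower bidiagonal matrices change places.\<close>

lemma algebra_iso_reverse:
  fixes f :: "'a \<Rightarrow> 'k::field mat"
  assumes f: "algebra_iso M (mat_algebra n) f"
  obtains g where "algebra_iso M (mat_algebra n) g"
    "\<And>x. x \<in> carrier M \<Longrightarrow> g x = mat n n (\<lambda>(i, j). f x $$ (n - 1 - i, n - 1 - j))"
proof
  define J where "J = mat n n (\<lambda>(i, j). if j = n - 1 - i then 1 else 0 :: 'k)"
  have Jc: "J \<in> carrier_mat n n" by (simp add: J_def)
  have left: "(J * Y) $$ (i, j) = Y $$ (n - 1 - i, j)"
    if "Y \<in> carrier_mat n n" "i < n" "j < n" for Y i j
  proof -
    have "(J * Y) $$ (i, j) = (\<Sum>k<n. if k = n - 1 - i then Y $$ (n - 1 - i, j) else 0)"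
      unfolding mult_mat_entry[OF Jc that] by (rule sum.cong) (use that in \<open>auto simp: J_def\<close>)
    then show ?thesis using that by simp
  qed
  have right: "(Y * J) $$ (i, j) = Y $$ (i, n - 1 - j)"
    if "Y \<in> carrier_mat n n" "i < n" "j < n" for Y i j
  proof -
    have "(Y * J) $$ (i, j) = (\<Sum>k<n. if k = n - 1 - j then Y $$ (i, n - 1 - j) else 0)"
      unfolding mult_mat_entry[OF that(1) Jc that(2,3)]
      by (rule sum.cong) (use that in \<open>auto simp: J_def\<close>)
    then show ?thesis using that by simp
  qed
  have "J * J = 1\<^sub>m n"
  proof (rule eq_matI)
    fix i j assume "i < dim_row (1\<^sub>m n :: 'k mat)" "j < dim_col (1\<^sub>m n :: 'k mat)"
    then have ij: "i < n" "j < n" by simp_all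
    then show "(J * J) $$ (i, j) = 1\<^sub>m n $$ (i, j)"
      unfolding left[OF Jc ij] by (auto simp: J_def)
  qed (simp_all add: J_def)
  then have J: "mutual_inverse n J J" using Jc by (simp add: mutual_inverse_def)
  show "algebra_iso M (mat_algebra n) (\<lambda>x. J * (f x * J))"
    by (rule algebra_iso_conj[OF J f])
  fix x assume "x \<in> carrier M"
  then have "f x \<in> carrier_mat n n"
    using algebra_isoD(1)[OF f] by (simp add: module_mat_simps)
  then show "J * (f x * J) = mat n n (\<lambda>(i, j). f x $$ (n - 1 - i, n - 1 - j))"
    using Jc by (intro eq_matI)
      (auto simp: left[of "f x * J"] right mult_carrier_mat[of _ n n] simp del: index_mult_mat(1))
qed

section \<open>Multiplicity-free elements\<close>

definition mat_poly :: "nat \<Rightarrow> 'k::field poly \<Rightarrow> 'k mat \<Rightarrow> 'k mat" where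
  "mat_poly n p X = mat n n (\<lambda>(a, b). \<Sum>i\<le>degree p. Polynomial.coeff p i * (X ^\<^sub>m i) $$ (a, b))"

lemma mat_poly_carrier [simp]: "mat_poly n p X \<in> carrier_mat n n"
  by (simp add: mat_poly_def)

lemma mat_poly_dim [simp]: "dim_row (mat_poly n p X) = n" "dim_col (mat_poly n p X) = n"
  by (simp_all add: mat_poly_def)

text \<open>The degree gives way to any upper bound, so that polynomials of different degrees can be
  summed over one range.\<close>

lemma mat_poly_entry:
  assumes "degree p \<le> N" "a < n" "b < n"
  shows "mat_poly n p X $$ (a, b) = (\<Sum>i\<le>N. Polynomial.coeff p i * (X ^\<^sub>m i) $$ (a, b))"
proof -
  have "(\<Sum>i\<le>degree p. Polynomial.coeff p i * (X ^\<^sub>m i) $$ (a, b)) = (\<Sum>i\<le>N. Polynomial.coeff p i * (X ^\<^sub>m i) $$ (a, b))"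
    using assms(1) by (intro sum.mono_neutral_left) (auto simp: coeff_eq_0)
  then show ?thesis using assms by (simp add: mat_poly_def)
qed

lemma mat_poly_diff: "mat_poly n (p - q) X = mat_poly n p X - mat_poly n q X"
proof (rule eq_matI)
  fix a b assume "a < dim_row (mat_poly n p X - mat_poly n q X)" "b < dim_col (mat_poly n p X - mat_poly n q X)"
  then have ab: "a < n" "b < n" by auto
  let ?N = "max (degree p) (degree q)"
  have "degree (p - q) \<le> ?N" by (rule degree_diff_le_max)
  then show "mat_poly n (p - q) X $$ (a, b) = (mat_poly n p X - mat_poly n q X) $$ (a, b)"
    using ab by (simp add: mat_poly_entry[of _ ?N] left_diff_distrib sum_subtractf)
qed auto

lemma mat_poly_smult: "mat_poly n (Polynomial.smult c p) X = c \<cdot>\<^sub>m mat_poly n p X"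
proof (rule eq_matI)
  fix a b assume "a < dim_row (c \<cdot>\<^sub>m mat_poly n p X)" "b < dim_col (c \<cdot>\<^sub>m mat_poly n p X)"
  then have ab: "a < n" "b < n" by auto
  then show "mat_poly n (Polynomial.smult c p) X $$ (a, b) = (c \<cdot>\<^sub>m mat_poly n p X) $$ (a, b)"
    by (simp add: mat_poly_entry[of _ "degree p"] degree_smult_le sum_distrib_left mult.assoc)
qed auto

lemma mat_poly_pCons_0:
  assumes X: "X \<in> carrier_mat n n"
  shows "mat_poly n (pCons 0 p) X = mat_poly n p X * X"
proof (rule eq_matI)
  fix a b assume "a < dim_row (mat_poly n p X * X)" "b < dim_col (mat_poly n p X * X)"
  then have ab: "a < n" "b < n" using X by auto
  have "mat_poly n (pCons 0 p) X $$ (a, b) = (\<Sum>i\<le>degree p. Polynomial.coeff p i * (X ^\<^sub>m Suc i) $$ (a, b))"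
    using ab degree_pCons_le[of 0 p]
    by (subst mat_poly_entry[of _ "Suc (degree p)"]) (simp_all only: sum.atMost_Suc_shift, simp)
  also have "\<dots> = (\<Sum>i\<le>degree p. \<Sum>k<n. Polynomial.coeff p i * (X ^\<^sub>m i) $$ (a, k) * X $$ (k, b))"
    using ab X
    by (simp add: mult_mat_entry[of _ n n _ n] pow_carrier_mat sum_distrib_left mult.assoc del: index_mult_mat(1))
  also have "\<dots> = (\<Sum>k<n. mat_poly n p X $$ (a, k) * X $$ (k, b))"
    using ab by (subst sum.swap) (simp add: mat_poly_entry[of _ "degree p"] sum_distrib_right)
  also have "\<dots> = (mat_poly n p X * X) $$ (a, b)"
    using ab X by (simp add: mult_mat_entry[of _ n n _ n] del: index_mult_mat(1))
  finally show "mat_poly n (pCons 0 p) X $$ (a, b) = (mat_poly n p X * X) $$ (a, b)" .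
qed (use X in auto)

text \<open>The columns of \<open>P\<close> are eigenvectors of \<open>X\<close>, and a polynomial
  in \<open>X\<close> acts on them through its values at the eigenvalues.\<close>

lemma mat_poly_mult_left:
  assumes X: "X \<in> carrier_mat n n" and P: "P \<in> carrier_mat n m"
    and XP: "\<And>i. (X ^\<^sub>m i) * P = P * diag_of m (\<lambda>j. t j ^ i)"
  shows "mat_poly n p X * P = P * diag_of m (\<lambda>j. poly p (t j))"
proof (rule eq_matI)
  fix a b assume "a < dim_row (P * diag_of m (\<lambda>j. poly p (t j)))" "b < dim_col (P * diag_of m (\<lambda>j. poly p (t j)))"
  then have ab: "a < n" "b < m" using P by auto
  have "(mat_poly n p X * P) $$ (a, b) =
      (\<Sum>k<n. \<Sum>i\<le>degree p. Polynomial.coeff p i * (X ^\<^sub>m i) $$ (a, k) * P $$ (k, b))"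
    using ab P by (simp add: mult_mat_entry[of _ n n _ m] mat_poly_entry[of _ "degree p"] sum_distrib_right del: index_mult_mat(1))
  also have "\<dots> = (\<Sum>i\<le>degree p. Polynomial.coeff p i * ((X ^\<^sub>m i) * P) $$ (a, b))"
    using ab P X
    by (subst sum.swap) (simp add: mult_mat_entry[of _ n n _ m] pow_carrier_mat sum_distrib_left mult.assoc del: index_mult_mat(1))
  also have "\<dots> = P $$ (a, b) * poly p (t b)"
    using ab P
    by (simp add: XP mult_diag_of_entry[of _ n m] poly_altdef sum_distrib_left mult.left_commute del: index_mult_mat(1))
  also have "\<dots> = (P * diag_of m (\<lambda>j. poly p (t j))) $$ (a, b)"
    using ab P by (simp add: mult_diag_of_entry[of _ n m] del: index_mult_mat(1))
  finally show "(mat_poly n p X * P) $$ (a, b) = (P * diag_of m (\<lambda>j. poly p (t j))) $$ (a, b)" .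
qed (use P in auto)

lemma mat_poly_left_commute:
  assumes X: "X \<in> carrier_mat n n"
  shows "X * mat_poly n p X = mat_poly n p X * X"
proof (rule eq_matI)
  have comm: "X * (X ^\<^sub>m i) = (X ^\<^sub>m i) * X" for i
  proof (induction i)
    case (Suc i)
    have "X * (X ^\<^sub>m Suc i) = X * (X ^\<^sub>m i) * X"
      using X by (simp add: assoc_mult_mat[of _ n n _ n _ n] pow_carrier_mat)
    then show ?case using Suc by simp
  qed (use X in simp)
  fix a b assume "a < dim_row (mat_poly n p X * X)" "b < dim_col (mat_poly n p X * X)"
  then have ab: "a < n" "b < n" using X by auto
  have "(X * mat_poly n p X) $$ (a, b) = (\<Sum>i\<le>degree p. \<Sum>k<n. X $$ (a, k) * (Polynomial.coeff p i * (X ^\<^sub>m i) $$ (k, b)))"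
    using ab X by (simp add: mult_mat_entry[of _ n n _ n] mat_poly_entry[of _ "degree p"] sum_distrib_left del: index_mult_mat(1))
      (rule sum.swap)
  also have "\<dots> = (\<Sum>i\<le>degree p. Polynomial.coeff p i * (X * (X ^\<^sub>m i)) $$ (a, b))"
    using ab X by (simp add: mult_mat_entry[of _ n n _ n] pow_carrier_mat sum_distrib_left mult.left_commute del: index_mult_mat(1))
  also have "\<dots> = (\<Sum>i\<le>degree p. \<Sum>k<n. Polynomial.coeff p i * (X ^\<^sub>m i) $$ (a, k) * X $$ (k, b))"
    unfolding comm using ab X by (simp add: mult_mat_entry[of _ n n _ n] pow_carrier_mat sum_distrib_left mult.assoc del: index_mult_mat(1))
  also have "\<dots> = (mat_poly n p X * X) $$ (a, b)"
    using ab X by (subst sum.swap) (simp add: mult_mat_entry[of _ n n _ n] mat_poly_entry[of _ "degree p"] sum_distrib_right del: index_mult_mat(1))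
  finally show "(X * mat_poly n p X) $$ (a, b) = (mat_poly n p X * X) $$ (a, b)" .
qed (use X in auto)

text \<open>The first \<open>n\<^sup>2 + 1\<close> powers of \<open>X\<close>, written as the columns of a matrix with a zero row appended, are
  linearly dependent.\<close>

lemma mat_poly_annihilator:
  fixes X :: "'k::field mat"
  assumes X: "X \<in> carrier_mat n n"
  obtains p where "p \<noteq> 0" "mat_poly n p X = 0\<^sub>m n n"
proof -
  define N where "N = Suc (n * n)"
  define W where "W = mat N N (\<lambda>(r, k). if r < n * n then (X ^\<^sub>m k) $$ (r div n, r mod n) else 0)"
  have Wc: "W \<in> carrier_mat N N" by (simp add: W_def)
  \<comment> \<open>The appended zero row makes \<open>W\<close> square and the last unit vector a
    left null vector, whence \<open>det W = 0\<close>.\<close>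
  have "transpose_mat W *\<^sub>v unit_vec N (n * n) = 0\<^sub>v N"
    by (rule eq_vecI) (auto simp: W_def N_def scalar_prod_def unit_vec_def)
  moreover have "unit_vec N (n * n) \<noteq> (0\<^sub>v N :: 'k vec)" by (simp add: N_def)
  ultimately have "det (transpose_mat W) = 0"
    using Wc by (subst det_0_iff_vec_prod_zero_field[of _ N]) (auto intro!: exI[of _ "unit_vec N (n * n)"])
  then have "det W = 0" using det_transpose[OF Wc] by simp
  then obtain v where v: "v \<in> carrier_vec N" "v \<noteq> 0\<^sub>v N" "W *\<^sub>v v = 0\<^sub>v N"
    using det_0_iff_vec_prod_zero_field[OF Wc] by blast
  define p where "p = (\<Sum>k<N. Polynomial.monom (v $ k) k)"
  have coeff_p: "Polynomial.coeff p i = (if i < N then v $ i else 0)" for i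
    by (simp add: p_def coeff_sum)
  have deg: "degree p \<le> n * n"
    by (rule degree_le) (auto simp: coeff_p N_def)
  have "p \<noteq> 0"
  proof
    assume "p = 0"
    then have "v $ i = 0" if "i < N" for i using coeff_p[of i] that by simp
    then show False using v by auto
  qed
  moreover have "mat_poly n p X = 0\<^sub>m n n"
  proof (rule eq_matI)
    fix a b assume "a < dim_row (0\<^sub>m n n :: 'k mat)" "b < dim_col (0\<^sub>m n n :: 'k mat)"
    then have ab: "a < n" "b < n" by auto
    \<comment> \<open>Position of entry \<open>(a, b)\<close> in the row-by-row list of entries:
      \<open>?r div n = a\<close> and \<open>?r mod n = b\<close>.\<close>
    let ?r = "a * n + b"
    have "a * n + b < a * n + n" using ab by simp
    also have "\<dots> \<le> n * n" using ab by (metis Suc_leI add.commute mult_Suc mult_le_mono1)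
    finally have r: "?r < n * n" .
    have "mat_poly n p X $$ (a, b) = (\<Sum>i<N. v $ i * (X ^\<^sub>m i) $$ (a, b))"
      unfolding mat_poly_entry[OF deg ab] by (rule sum.cong) (auto simp: coeff_p N_def)
    also have "\<dots> = (W *\<^sub>v v) $ ?r"
      using r ab v(1) by (auto simp: W_def N_def scalar_prod_def atLeast0LessThan mult.commute intro!: sum.cong)
    also have "\<dots> = 0" using v(3) r by (simp add: N_def)
    finally show "mat_poly n p X $$ (a, b) = 0\<^sub>m n n $$ (a, b)" using ab by simp
  qed auto
  ultimately show thesis using that by blast
qed

section \<open>From the abstract algebra to matrices\<close>

lemma alg_eval_image:
  fixes f :: "'a \<Rightarrow> 'k::field mat"
  assumes M: "assoc_algebra M" and f: "algebra_iso M (mat_algebra n) f" and x: "x \<in> carrier M"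
  shows "alg_eval M p x \<in> carrier M" "f (alg_eval M p x) = mat_poly n p (f x)"
proof -
  interpret ring M using M by (simp add: assoc_algebra_def)
  interpret Module.module class_ring M using M by (simp add: assoc_algebra_def)
  note iso = algebra_isoD[OF f, unfolded module_mat_simps]
  have smult_in: "c \<odot>\<^bsub>M\<^esub> y \<in> carrier M" if "y \<in> carrier M" for c y
    using that by (simp add: smult_closed)
  have pow: "f (x [^]\<^bsub>M\<^esub> (i::nat)) = (f x) ^\<^sub>m i" for i
    using x iso(1)[OF x] by (induction i) (auto simp: iso(2,4))
  let ?t = "\<lambda>i. Polynomial.coeff p i \<odot>\<^bsub>M\<^esub> (x [^]\<^bsub>M\<^esub> i)"
  have t: "?t i \<in> carrier M" for i using x by (simp add: smult_in)
  show "alg_eval M p x \<in> carrier M"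
    unfolding alg_eval_def using t by (intro finsum_closed) auto
  \<comment> \<open>Only the summation bound varies in this induction; the polynomial
    \<open>p\<close> stays fixed.\<close>
  have "f (\<Oplus>\<^bsub>M\<^esub>i\<in>{..N}. ?t i) = mat n n (\<lambda>(a, b). \<Sum>i\<le>N. Polynomial.coeff p i * ((f x) ^\<^sub>m i) $$ (a, b))" for N
  proof (induction N)
    case 0
    have "f (?t 0) = Polynomial.coeff p 0 \<cdot>\<^sub>m (f x ^\<^sub>m 0)"
      using iso(5)[of "x [^]\<^bsub>M\<^esub> (0::nat)" "Polynomial.coeff p 0"] x pow[of 0] by simp
    then show ?case using t[of 0] iso(1)[OF x] by auto
  next
    case (Suc N)
    have "(\<Oplus>\<^bsub>M\<^esub>i\<in>{..Suc N}. ?t i) = ?t (Suc N) \<oplus>\<^bsub>M\<^esub> (\<Oplus>\<^bsub>M\<^esub>i\<in>{..N}. ?t i)"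
      using t by (intro finsum_Suc) auto
    moreover have "(\<Oplus>\<^bsub>M\<^esub>i\<in>{..N}. ?t i) \<in> carrier M"
      using t by (intro finsum_closed) auto
    ultimately have "f (\<Oplus>\<^bsub>M\<^esub>i\<in>{..Suc N}. ?t i) = f (?t (Suc N)) + f (\<Oplus>\<^bsub>M\<^esub>i\<in>{..N}. ?t i)"
      using iso(3)[OF t[of "Suc N"]] by simp
    also have "f (?t (Suc N)) = Polynomial.coeff p (Suc N) \<cdot>\<^sub>m (f x ^\<^sub>m Suc N)"
      unfolding pow[symmetric] using x by (intro iso(5)) simp
    finally show ?case
      unfolding Suc using iso(1)[OF x] pow_carrier_mat[OF iso(1)[OF x], of "Suc N"]
      by (intro eq_matI) (auto simp: add.commute simp del: pow_mat.simps index_mult_mat)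
  qed
  then show "f (alg_eval M p x) = mat_poly n p (f x)"
    by (simp add: alg_eval_def mat_poly_def)
qed

lemma algebra_iso_eq_zero_iff:
  fixes f :: "'a \<Rightarrow> 'k::field mat"
  assumes M: "assoc_algebra M" and f: "algebra_iso M (mat_algebra n) f" and x: "x \<in> carrier M"
  shows "x = \<zero>\<^bsub>M\<^esub> \<longleftrightarrow> f x = 0\<^sub>m n n"
proof -
  interpret ring M using M by (simp add: assoc_algebra_def)
  note iso = algebra_isoD[OF f, unfolded module_mat_simps]
  have "f \<zero>\<^bsub>M\<^esub> = f \<zero>\<^bsub>M\<^esub> + f \<zero>\<^bsub>M\<^esub>" using iso(3)[of "\<zero>\<^bsub>M\<^esub>" "\<zero>\<^bsub>M\<^esub>"] by simp
  then have "f \<zero>\<^bsub>M\<^esub> $$ (i, j) = 0" if "i < n" "j < n" for i j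
    using that iso(1)[of "\<zero>\<^bsub>M\<^esub>"] by (metis add_cancel_right_right carrier_matD index_add_mat(1) zero_closed)
  then have "f \<zero>\<^bsub>M\<^esub> = 0\<^sub>m n n"
    using iso(1)[of "\<zero>\<^bsub>M\<^esub>"] by (intro eq_matI) auto
  moreover have "inj_on f (carrier M)" using iso(6) by (simp add: bij_betw_def)
  ultimately show ?thesis using x by (metis inj_onD zero_closed)
qed

text \<open>\<open>min_poly\<close> is a definite description, so its properties require that
  exactly one monic annihilating polynomial of least degree exists. Existence comes from normalizing
  an annihilator of least degree in the matrix algebra.\<close>

lemma min_poly_exists:
  fixes f :: "'a \<Rightarrow> 'k::field mat"
  assumes M: "assoc_algebra M" and f: "algebra_iso M (mat_algebra n) f" and x: "x \<in> carrier M"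
  shows "lead_coeff (min_poly M x) = 1" "mat_poly n (min_poly M x) (f x) = 0\<^sub>m n n"
    "\<And>q. q \<noteq> 0 \<Longrightarrow> mat_poly n q (f x) = 0\<^sub>m n n \<Longrightarrow> degree (min_poly M x) \<le> degree q"
proof -
  have zero: "alg_eval M p x = \<zero>\<^bsub>M\<^esub> \<longleftrightarrow> mat_poly n p (f x) = 0\<^sub>m n n" for p
    using algebra_iso_eq_zero_iff[OF M f alg_eval_image(1)[OF M f x]] alg_eval_image(2)[OF M f x] by simp
  let ?ann = "\<lambda>p. p \<noteq> 0 \<and> mat_poly n p (f x) = 0\<^sub>m n n"
  let ?min = "\<lambda>p. lead_coeff p = 1 \<and> mat_poly n p (f x) = 0\<^sub>m n n \<and>
     (\<forall>q. q \<noteq> 0 \<and> mat_poly n q (f x) = 0\<^sub>m n n \<longrightarrow> degree p \<le> degree q)"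
  have "f x \<in> carrier_mat n n" using algebra_isoD(1)[OF f x] by (simp add: module_mat_simps)
  then obtain p0 where "?ann p0" using mat_poly_annihilator by blast
  then obtain p where p: "?ann p" "\<And>q. ?ann q \<Longrightarrow> degree p \<le> degree q"
    using ex_has_least_nat[of ?ann p0 degree] by blast
  let ?p = "Polynomial.smult (inverse (lead_coeff p)) p"
  have "?min ?p" using p by (auto simp: mat_poly_smult)
  \<comment> \<open>The difference of two candidates annihilates as well, but the leading terms
    cancel, so minimality forces it to be zero.\<close>
  moreover have "q = ?p" if q: "?min q" for q
  proof (rule ccontr)
    assume ne: "q \<noteq> ?p"
    have "q \<noteq> 0" using q by auto
    then have deg: "degree q = degree ?p" using q \<open>?min ?p\<close> p(1) by (intro antisym) auto
    have "mat_poly n (q - ?p) (f x) = 0\<^sub>m n n"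
      using q \<open>?min ?p\<close> by (simp add: mat_poly_diff)
    then have "degree q \<le> degree (q - ?p)" using q ne by auto
    moreover have "degree (q - ?p) \<le> degree q" using deg by (intro degree_diff_le) auto
    moreover have "Polynomial.coeff (q - ?p) (degree q) = 0" using q \<open>?min ?p\<close> deg by simp
    ultimately show False using eq_zero_or_degree_less[of "q - ?p" "degree q"] ne by auto
  qed
  ultimately have "min_poly M x = ?p"
    unfolding min_poly_def zero by (intro the_equality) auto
  then show "lead_coeff (min_poly M x) = 1" "mat_poly n (min_poly M x) (f x) = 0\<^sub>m n n"
    "\<And>q. q \<noteq> 0 \<Longrightarrow> mat_poly n q (f x) = 0\<^sub>m n n \<Longrightarrow> degree (min_poly M x) \<le> degree q"
    using \<open>?min ?p\<close> by auto
qed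

text \<open>Split off the root: \<open>min_poly M x = [:- t, 1:] * q\<close>. By minimality
  \<open>q\<close> does not annihilate \<open>f x\<close>, and the nonzero columns of
  \<open>mat_poly n q (f x)\<close> are eigenvectors.\<close>

lemma eigvals_eigenvector:
  fixes f :: "'a \<Rightarrow> 'k::field mat"
  assumes M: "assoc_algebra M" and f: "algebra_iso M (mat_algebra n) f" and x: "x \<in> carrier M"
    and t: "t \<in> eigvals M x"
  obtains v where "v \<in> carrier_vec n" "v \<noteq> 0\<^sub>v n" "f x *\<^sub>v v = t \<cdot>\<^sub>v v"
proof -
  let ?m = "min_poly M x"
  note m = min_poly_exists[OF M f x]
  have X: "f x \<in> carrier_mat n n" using algebra_isoD(1)[OF f x] by (simp add: module_mat_simps)
  obtain q where q: "?m = [:- t, 1:] * q"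
    using t by (auto simp: eigvals_def poly_eq_0_iff_dvd dvd_def)
  have "q \<noteq> 0" using q m(1) by auto
  then have "degree ?m = Suc (degree q)" unfolding q by (subst degree_mult_eq) auto
  then have "mat_poly n q (f x) \<noteq> 0\<^sub>m n n" using m(3)[OF \<open>q \<noteq> 0\<close>] by auto
  then obtain a c where ac: "a < n" "c < n" "mat_poly n q (f x) $$ (a, c) \<noteq> 0"
    by (metis eq_matI index_zero_mat mat_poly_dim)
  have "?m = pCons 0 q - Polynomial.smult t q" unfolding q by simp
  then have "mat_poly n q (f x) * f x - t \<cdot>\<^sub>m mat_poly n q (f x) = 0\<^sub>m n n"
    using m(2) by (simp add: mat_poly_diff mat_poly_smult mat_poly_pCons_0[OF X])
  \<comment> \<open>\<open>f x\<close> has to stand on the left in order to act on columns.\<close>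
  then have "f x * mat_poly n q (f x) - t \<cdot>\<^sub>m mat_poly n q (f x) = 0\<^sub>m n n"
    by (simp add: mat_poly_left_commute[OF X])
  then have eq: "(f x * mat_poly n q (f x)) $$ (i, c) = t * mat_poly n q (f x) $$ (i, c)" if "i < n" for i
    using that ac X by (auto simp: mat_eq_iff simp del: index_mult_mat(1))
  show thesis
  proof
    show "col (mat_poly n q (f x)) c \<in> carrier_vec n" using ac by (intro col_carrier_vec) auto
    show "col (mat_poly n q (f x)) c \<noteq> 0\<^sub>v n"
      using ac by (metis index_col index_zero_vec(1) mat_poly_dim)
    show "f x *\<^sub>v col (mat_poly n q (f x)) c = t \<cdot>\<^sub>v col (mat_poly n q (f x)) c"
      using eq X ac by (intro eq_vecI) auto
  qed
qed

section \<open>Diagonalization of multiplicity-free elements\<close>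

lemma mult_mat_vec_entry:
  assumes "A \<in> carrier_mat n m" "v \<in> carrier_vec m" "i < n"
  shows "(A *\<^sub>v v) $ i = (\<Sum>k<m. A $$ (i, k) * v $ k)"
  using assms by (auto simp: scalar_prod_def atLeast0LessThan intro!: sum.cong)

text \<open>Eigenvectors for distinct eigenvalues are independent, so they form an invertible
  matrix. The diagonal form is recorded for all polynomials in \<open>X\<close> because primitive
  idempotents are such polynomials.\<close>

lemma eigenbasis:
  fixes X :: "'k::field mat"
  assumes X: "X \<in> carrier_mat n n" and t: "inj_on t {..<n}"
    and ev: "\<And>i. i < n \<Longrightarrow> v i \<in> carrier_vec n \<and> v i \<noteq> 0\<^sub>v n \<and> X *\<^sub>v v i = t i \<cdot>\<^sub>v v i"
  obtains P P' where "mutual_inverse n P P'" "X = P * (diag_of n t * P')"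
    "\<And>p. mat_poly n p X = P * (diag_of n (\<lambda>j. poly p (t j)) * P')"
proof -
  define P where "P = mat n n (\<lambda>(a, i). v i $ a)"
  have Pc [simp]: "P \<in> carrier_mat n n" by (simp add: P_def)
  have P_entry: "P $$ (a, b) = v b $ a" if "a < n" "b < n" for a b
    using that by (simp add: P_def)
  have XP: "X * P = P * diag_of n t"
  proof (rule eq_matI)
    fix a b assume "a < dim_row (P * diag_of n t)" "b < dim_col (P * diag_of n t)"
    then have ab: "a < n" "b < n" by (auto simp: P_def)
    have "(X * P) $$ (a, b) = (X *\<^sub>v v b) $ a"
      using ab X ev[of b, THEN conjunct1] by (auto simp: P_def scalar_prod_def intro!: sum.cong)
    then show "(X * P) $$ (a, b) = (P * diag_of n t) $$ (a, b)"
      using ab ev[of b, THEN conjunct1, THEN carrier_vecD] ev[of b] P_entry[OF ab] by (simp add: mult_diag_of_entry[OF Pc] mult.commute del: index_mult_mat(1))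
  qed (use X in \<open>auto simp: P_def\<close>)
  have XP_pow: "(X ^\<^sub>m i) * P = P * diag_of n (\<lambda>j. t j ^ i)" for i
  proof (induction i)
    case 0
    have "diag_of n (\<lambda>j. t j ^ 0) = 1\<^sub>m n" by (auto simp: diag_of_def)
    then show ?case using X left_mult_one_mat[OF Pc] right_mult_one_mat[OF Pc] by simp
  next
    case (Suc i)
    have "(X ^\<^sub>m Suc i) * P = (X ^\<^sub>m i) * (X * P)"
      using X by (simp add: assoc_mult_mat[of _ n n _ n _ n] pow_carrier_mat)
    also have "\<dots> = (X ^\<^sub>m i) * P * diag_of n t"
      unfolding XP using X by (simp add: assoc_mult_mat[of _ n n _ n _ n] pow_carrier_mat)
    also have "\<dots> = P * (diag_of n (\<lambda>j. t j ^ i) * diag_of n t)"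
      unfolding Suc by (simp add: assoc_mult_mat[of _ n n _ n _ n])
    finally show ?case by (simp add: diag_of_mult_diag_of mult.commute)
  qed
  note polyP = mat_poly_mult_left[OF X Pc XP_pow]
  have "det P \<noteq> 0"
  proof
    assume "det P = 0"
    then obtain c where c: "c \<in> carrier_vec n" "c \<noteq> 0\<^sub>v n" "P *\<^sub>v c = 0\<^sub>v n"
      using det_0_iff_vec_prod_zero_field[OF Pc] by blast
    obtain i where i: "i < n" "c $ i \<noteq> 0" using c by (metis carrier_vecD eq_vecI index_zero_vec)
    \<comment> \<open>Vanishes at every eigenvalue except \<open>t i\<close>; applied to the
      dependency among the columns of \<open>P\<close>, it isolates the term with
      \<open>v i\<close>.\<close>
    define p where "p = (\<Prod>j\<in>{..<n} - {i}. [:- t j, 1:])"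
    have p0: "poly p (t j) = 0" if "j < n" "j \<noteq> i" for j
      using that by (auto simp: p_def poly_prod)
    have pi: "poly p (t i) \<noteq> 0"
      using i t by (auto simp: p_def poly_prod inj_on_def)
    have "v i $ a = 0" if a: "a < n" for a
    proof -
      have "mat_poly n p X * P *\<^sub>v c = mat_poly n p X *\<^sub>v (P *\<^sub>v c)"
        using c by (intro assoc_mult_mat_vec) auto
      then have "(P * diag_of n (\<lambda>j. poly p (t j)) *\<^sub>v c) $ a = (mat_poly n p X *\<^sub>v 0\<^sub>v n) $ a"
        unfolding polyP c(3) by simp
      also have "\<dots> = 0" using a by simp
      finally have "0 = (P * diag_of n (\<lambda>j. poly p (t j)) *\<^sub>v c) $ a" by simp
      also have "\<dots> = (\<Sum>k<n. (P * diag_of n (\<lambda>j. poly p (t j))) $$ (a, k) * c $ k)"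
        using a by (rule mult_mat_vec_entry[OF mult_carrier_mat[OF Pc bidiag_carrier(1)] c(1)])
      also have "\<dots> = (\<Sum>k<n. if k = i then v i $ a * poly p (t i) * c $ i else 0)"
        using a p0 by (intro sum.cong) (auto simp: mult_diag_of_entry[OF Pc] P_entry simp del: index_mult_mat(1))
      also have "\<dots> = v i $ a * poly p (t i) * c $ i" using i by simp
      finally show ?thesis using pi i by simp
    qed
    then have "v i = 0\<^sub>v n" using ev[OF i(1)] by (intro eq_vecI) auto
    then show False using ev[OF i(1)] by simp
  qed
  then obtain P' where P': "mutual_inverse n P P'" using mutual_inverse_of_det[OF Pc] by blast
  then have P'c: "P' \<in> carrier_mat n n" and one: "P * P' = 1\<^sub>m n" by (simp_all add: mutual_inverse_def)
  have cancel: "Z = P * (D * P')" if "Z * P = P * D" "Z \<in> carrier_mat n n" "D \<in> carrier_mat n n" for Z D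
  proof -
    have "Z = Z * (P * P')" using that one by simp
    also have "\<dots> = Z * P * P'" by (rule assoc_mult_mat[OF that(2) Pc P'c, symmetric])
    also have "\<dots> = P * (D * P')" unfolding that(1) using that P'c by (simp add: assoc_mult_mat[of _ n n _ n _ n])
    finally show ?thesis .
  qed
  show thesis
    by (rule that[OF P' cancel[OF XP X] cancel[OF polyP]]) simp_all
qed

text \<open>The polynomial in \<open>prim_idem\<close> is the Lagrange polynomial of
  \<open>t i\<close>, so in the eigenbasis \<open>Es ! i\<close> is the projection to coordinate
  \<open>i\<close>. The enumeration \<open>t\<close> is the one imposed by the list
  \<open>Es\<close>, as in the eigenvalue sequences.\<close>

lemma multiplicity_free_diagonalization:
  fixes f :: "'a \<Rightarrow> 'k::field mat"
  assumes M: "assoc_algebra M" and f: "algebra_iso M (mat_algebra (d + 1)) f"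
    and x: "multiplicity_free d M x" and Es: "ordering_of_prim_idems d M x Es"
  obtains t P P' where "inj_on t {..<d + 1}" "mutual_inverse (d + 1) P P'"
    "f x = P * (diag_of (d + 1) t * P')"
    "\<And>i. i < d + 1 \<Longrightarrow> f (Es ! i) = P * (diag_of (d + 1) (\<lambda>j. if j = i then 1 else 0) * P')"
    "\<And>i. i < d + 1 \<Longrightarrow> (THE s. s \<in> eigvals M x \<and> prim_idem M x s = Es ! i) = t i"
    "\<And>i. i < d + 1 \<Longrightarrow> Es ! i \<in> carrier M"
proof -
  let ?n = "d + 1"
  have xc: "x \<in> carrier M" and card: "card (eigvals M x) = ?n"
    using x by (simp_all add: multiplicity_free_def)
  have fin: "finite (eigvals M x)" using card by (intro card_ge_0_finite) simp
  have Es': "length Es = ?n" "distinct Es" "set Es = prim_idem M x ` eigvals M x"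
    using Es by (simp_all add: ordering_of_prim_idems_def)
  \<comment> \<open>\<open>d + 1\<close> distinct idempotents come from \<open>d + 1\<close>
    eigenvalues, so no two eigenvalues share one.\<close>
  have inj: "inj_on (prim_idem M x) (eigvals M x)"
    using fin distinct_card[OF Es'(2)] Es'(1,3) card by (intro eq_card_imp_inj_on) simp_all
  define t where "t i = inv_into (eigvals M x) (prim_idem M x) (Es ! i)" for i
  have Es_in: "Es ! i \<in> prim_idem M x ` eigvals M x" if "i < ?n" for i
    using nth_mem[of i Es] that Es' by simp
  have t_in: "t i \<in> eigvals M x" and t_idem: "prim_idem M x (t i) = Es ! i" if "i < ?n" for i
    using Es_in[OF that] by (auto simp: t_def inv_into_into f_inv_into_f)
  have t_inj: "inj_on t {..<?n}"
    using t_idem Es' by (auto simp: inj_on_def nth_eq_iff_index_eq) (metis Suc_eq_plus1 nth_eq_iff_index_eq)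
  have eig: "eigvals M x = t ` {..<?n}"
    using t_in fin card card_image[OF t_inj] by (intro card_subset_eq[symmetric]) auto
  have X: "f x \<in> carrier_mat ?n ?n" using algebra_isoD(1)[OF f xc] by (simp add: module_mat_simps)
  have "\<exists>v. v \<in> carrier_vec ?n \<and> v \<noteq> 0\<^sub>v ?n \<and> f x *\<^sub>v v = t i \<cdot>\<^sub>v v" if "i < ?n" for i
    using eigvals_eigenvector[OF M f xc t_in[OF that]] by metis
  then obtain v where v: "\<And>i. i < ?n \<Longrightarrow> v i \<in> carrier_vec ?n \<and> v i \<noteq> 0\<^sub>v ?n \<and> f x *\<^sub>v v i = t i \<cdot>\<^sub>v v i"
    by metis
  obtain P P' where P: "mutual_inverse ?n P P'" "f x = P * (diag_of ?n t * P')"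
    "\<And>p. mat_poly ?n p (f x) = P * (diag_of ?n (\<lambda>j. poly p (t j)) * P')"
    using eigenbasis[OF X t_inj v] by blast
  show thesis
  proof (rule that[OF t_inj P(1,2)])
    fix i assume i: "i < ?n"
    let ?p = "\<Prod>s\<in>eigvals M x - {t i}. Polynomial.smult (1 / (t i - s)) [:- s, 1:]"
    have Ei: "Es ! i = alg_eval M ?p x" using t_idem[OF i] by (simp add: prim_idem_def)
    have "diag_of ?n (\<lambda>j. poly ?p (t j)) = diag_of ?n (\<lambda>j. if j = i then 1 else 0)"
    proof -
      have "poly ?p (t j) = (if j = i then 1 else 0)" if "j < ?n" for j
      proof (cases "j = i")
        case True
        have "poly ?p (t i) = (\<Prod>s\<in>eigvals M x - {t i}. 1)"
          unfolding poly_prod by (rule prod.cong) (auto simp: field_simps)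
        then show ?thesis using True by simp
      next
        case False
        then have "t j \<noteq> t i" using t_inj that i by (auto simp: inj_on_def)
        then have "poly ?p (t j) = 0"
          unfolding poly_prod using fin t_in[OF that] by (intro prod_zero) (auto intro!: bexI[of _ "t j"])
        then show ?thesis using False by simp
      qed
      then show ?thesis by (auto simp: diag_of_def)
    qed
    then show "f (Es ! i) = P * (diag_of ?n (\<lambda>j. if j = i then 1 else 0) * P')"
      unfolding Ei alg_eval_image(2)[OF M f xc] P(3) by simp
    show "Es ! i \<in> carrier M" unfolding Ei by (rule alg_eval_image(1)[OF M f xc])
    show "(THE s. s \<in> eigvals M x \<and> prim_idem M x s = Es ! i) = t i"
      using t_in[OF i] t_idem[OF i] inj by (intro the_equality) (auto simp: inj_on_def)
  qed
qed

section \<open>Existence of the split form\<close>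

text \<open>In the eigenbasis the idempotents are coordinate projections, so multiplying
  \<open>y\<close> by them on both sides keeps exactly one entry of its matrix.\<close>

lemma tridiagonal_on_irred:
  fixes f :: "'a \<Rightarrow> 'k::field mat"
  assumes n: "n = d + 1" and M: "assoc_algebra M" and f: "algebra_iso M (mat_algebra n) f"
    and P: "mutual_inverse n P P'"
    and Es: "\<And>i. i < n \<Longrightarrow> f (Es ! i) = P * (diag_of n (\<lambda>j. if j = i then 1 else 0) * P')"
      "\<And>i. i < n \<Longrightarrow> Es ! i \<in> carrier M"
    and y: "y \<in> carrier M" and tri: "tridiagonal_on d M Es y"
  shows "irred_tridiag n (P' * (f y * P))"
proof -
  interpret ring M using M by (simp add: assoc_algebra_def)
  note assoc = assoc_mult_mat[of _ n n _ n _ n] mult_carrier_mat[of _ n n _ n]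
  note iso = algebra_isoD[OF f, unfolded module_mat_simps]
  have c [simp]: "P \<in> carrier_mat n n" "P' \<in> carrier_mat n n" "f y \<in> carrier_mat n n"
    using P iso(1)[OF y] by (simp_all add: mutual_inverse_def)
  let ?D = "\<lambda>i. diag_of n (\<lambda>j. if j = i then 1 else 0 :: 'k)"
  let ?Z = "P' * (f y * P)"
  have Zc: "?Z \<in> carrier_mat n n" by (simp add: assoc)
  have "Es ! i \<otimes>\<^bsub>M\<^esub> y \<otimes>\<^bsub>M\<^esub> Es ! j = \<zero>\<^bsub>M\<^esub> \<longleftrightarrow> ?Z $$ (i, j) = 0" if ij: "i < n" "j < n" for i j
  proof -
    have "f (Es ! i \<otimes>\<^bsub>M\<^esub> y \<otimes>\<^bsub>M\<^esub> Es ! j) = f (Es ! i) * f y * f (Es ! j)"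
      using Es(2)[OF ij(1)] Es(2)[OF ij(2)] y by (simp add: iso(2))
    also have "\<dots> = P * (?D i * ?Z * ?D j * P')"
      by (simp add: Es(1) ij assoc)
    finally have eq: "f (Es ! i \<otimes>\<^bsub>M\<^esub> y \<otimes>\<^bsub>M\<^esub> Es ! j) = P * (?D i * ?Z * ?D j * P')" .
    have "Es ! i \<otimes>\<^bsub>M\<^esub> y \<otimes>\<^bsub>M\<^esub> Es ! j = \<zero>\<^bsub>M\<^esub> \<longleftrightarrow> P * (?D i * ?Z * ?D j * P') = 0\<^sub>m n n"
      unfolding eq[symmetric] using Es(2) ij y by (intro algebra_iso_eq_zero_iff[OF M f]) simp
    also have "\<dots> \<longleftrightarrow> ?D i * ?Z * ?D j = 0\<^sub>m n n"
    proof
      assume z: "P * (?D i * ?Z * ?D j * P') = 0\<^sub>m n n"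
      have W: "?D i * ?Z * ?D j \<in> carrier_mat n n" using Zc by (simp add: assoc(2))
      have "?D i * ?Z * ?D j = P' * (P * (?D i * ?Z * ?D j * P')) * P"
        using P W mutual_inverse_cancel(2)[OF P, of "?D i * ?Z * ?D j * P'" n]
        by (simp add: assoc_mult_mat[OF W c(2,1)] right_mult_one_mat[OF W] assoc(2) mutual_inverse_def)
      then show "?D i * ?Z * ?D j = 0\<^sub>m n n" unfolding z by (simp add: right_mult_zero_mat[OF c(2)] left_mult_zero_mat[OF c(1)])
    qed (simp add: right_mult_zero_mat[OF c(1)] left_mult_zero_mat[OF c(2)])
    also have "\<dots> \<longleftrightarrow> ?Z $$ (i, j) = 0"
    proof -
      have entry: "(?D i * ?Z * ?D j) $$ (a, b) = (if a = i \<and> b = j then ?Z $$ (i, j) else 0)"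
        if "a < n" "b < n" for a b
        using mult_diag_of_entry[of "?D i * ?Z" n n a b] diag_of_mult_entry[OF Zc that] that Zc
        by (simp add: assoc(2) del: index_mult_mat(1))
      show ?thesis
      proof
        assume "?D i * ?Z * ?D j = 0\<^sub>m n n"
        then have "(?D i * ?Z * ?D j) $$ (i, j) = 0" using ij by simp
        then show "?Z $$ (i, j) = 0" unfolding entry[OF ij] by simp
      next
        assume "?Z $$ (i, j) = 0"
        then have "(?D i * ?Z * ?D j) $$ (a, b) = 0" if "a < n" "b < n" for a b
          unfolding entry[OF that] by simp
        then show "?D i * ?Z * ?D j = 0\<^sub>m n n"
          by (intro eq_matI) (simp_all del: index_mult_mat(1))
      qed
    qed
    finally show ?thesis .
  qed
  then show ?thesis
    using tri n unfolding irred_tridiag_def tridiagonal_on_def by (simp add: less_Suc_eq_le del: index_mult_mat(1))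
qed

text \<open>The intertwiner \<open>S\<close> is produced together with the split form because it is
  built from \<open>C\<close> and \<open>Y\<close>, which the split form itself no longer shows. It
  is the source of the symmetry between the two elements.\<close>

lemma leonard_system_split_form:
  fixes M :: "('k::field, 'a, 'm) module_scheme"
  assumes n: "n = d + 1" and \<Phi>: "leonard_system d M \<Phi>"
  obtains f vp S S' where "split_form d M \<Phi> f vp" "\<And>i. 0 < i \<Longrightarrow> i < n \<Longrightarrow> vp i \<noteq> 0"
    "mutual_inverse n S S'"
    "S * f (elt \<Phi>) = transpose_mat (f (elt \<Phi>)) * S"
    "S * f (dual_elt \<Phi>) = transpose_mat (f (dual_elt \<Phi>)) * S"
    "inj_on (dual_eigenvalue_seq M \<Phi>) {..<n}"
proof -
  note assoc = assoc_mult_mat[of _ n n _ n _ n] mult_carrier_mat[of _ n n _ n]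
  have M: "assoc_algebra M" and mf: "multiplicity_free d M (elt \<Phi>)" "multiplicity_free d M (dual_elt \<Phi>)"
    and ord: "ordering_of_prim_idems d M (elt \<Phi>) (idems \<Phi>)"
      "ordering_of_prim_idems d M (dual_elt \<Phi>) (dual_idems \<Phi>)"
    and tri: "tridiagonal_on d M (idems \<Phi>) (dual_elt \<Phi>)" "tridiagonal_on d M (dual_idems \<Phi>) (elt \<Phi>)"
    using \<Phi> by (simp_all add: leonard_system_def)
  obtain f0 where f0: "algebra_iso M (mat_algebra n) f0"
    using \<Phi> by (auto simp: leonard_system_def n)
  have el: "elt \<Phi> \<in> carrier M" "dual_elt \<Phi> \<in> carrier M"
    using mf by (simp_all add: multiplicity_free_def)
  obtain t R R' where R: "inj_on t {..<n}" "mutual_inverse n R R'" "f0 (elt \<Phi>) = R * (diag_of n t * R')"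
    "\<And>i. i < n \<Longrightarrow> f0 (idems \<Phi> ! i) = R * (diag_of n (\<lambda>j. if j = i then 1 else 0) * R')"
    "\<And>i. i < n \<Longrightarrow> (THE s. s \<in> eigvals M (elt \<Phi>) \<and> prim_idem M (elt \<Phi>) s = idems \<Phi> ! i) = t i"
    "\<And>i. i < n \<Longrightarrow> idems \<Phi> ! i \<in> carrier M"
    using multiplicity_free_diagonalization[OF M f0[unfolded n] mf(1) ord(1), folded n] by blast
  obtain ts P P' where P: "inj_on ts {..<n}" "mutual_inverse n P P'" "f0 (dual_elt \<Phi>) = P * (diag_of n ts * P')"
    "\<And>i. i < n \<Longrightarrow> f0 (dual_idems \<Phi> ! i) = P * (diag_of n (\<lambda>j. if j = i then 1 else 0) * P')"
    "\<And>i. i < n \<Longrightarrow> (THE s. s \<in> eigvals M (dual_elt \<Phi>) \<and> prim_idem M (dual_elt \<Phi>) s = dual_idems \<Phi> ! i) = ts i"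
    "\<And>i. i < n \<Longrightarrow> dual_idems \<Phi> ! i \<in> carrier M"
    using multiplicity_free_diagonalization[OF M f0[unfolded n] mf(2) ord(2), folded n] by blast
  have seq: "eigenvalue_seq M \<Phi> i = t i" "dual_eigenvalue_seq M \<Phi> i = ts i" if "i < n" for i
    using R(5)[OF that] P(5)[OF that] by (simp_all add: eigenvalue_seq_def dual_eigenvalue_seq_def)
  have c [simp]: "P \<in> carrier_mat n n" "P' \<in> carrier_mat n n" "R \<in> carrier_mat n n" "R' \<in> carrier_mat n n"
    using P(2) R(2) by (simp_all add: mutual_inverse_def)
  \<comment> \<open>The columns of \<open>P\<close> and \<open>R\<close> are eigenvectors of the
    dual element and of the element. So \<open>B\<close> is the transition matrix between the
    eigenbases, and \<open>X\<close> and \<open>Y\<close> are each element written in the eigenbasis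
    of the other.\<close>
  define B where "B = P' * R"
  define B' where "B' = R' * P"
  have B: "mutual_inverse n B B'"
    unfolding B_def B'_def by (rule mutual_inverse_mult[OF mutual_inverse_sym[OF P(2)] R(2)])
  define X where "X = P' * (f0 (elt \<Phi>) * P)"
  define Y where "Y = R' * (f0 (dual_elt \<Phi>) * R)"
  have X: "X = B * (diag_of n t * B')" and Y: "Y = B' * (diag_of n ts * B)"
    by (simp_all add: X_def Y_def R(3) P(3) B_def B'_def assoc)
  have X_tri: "irred_tridiag n X"
    unfolding X_def by (rule tridiagonal_on_irred[OF n M f0 P(2,4,6) el(1) tri(2)])
  have Y_tri: "irred_tridiag n Y"
    unfolding Y_def by (rule tridiagonal_on_irred[OF n M f0 R(2,4,6) el(2) tri(1)])
  have n0: "0 < n" by (simp add: n)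
  obtain Q Q' C vp where Q: "mutual_inverse n Q Q'"
    "Q' * (X * Q) = lower_bidiag n t (\<lambda>_. 1)" "Q' * (diag_of n ts * Q) = upper_bidiag n ts vp"
    "\<And>i. 0 < i \<Longrightarrow> i < n \<Longrightarrow> vp i \<noteq> 0" and C: "C \<in> carrier_mat n n" "det C \<noteq> 0"
    "diag_of n t * C = C * lower_bidiag n t (\<lambda>_. 1)" "C * upper_bidiag n ts vp = Y * C"
    by (rule bidiagonalization[OF n0 B X X_tri Y Y_tri]) (rule that)
  have Qc [simp]: "Q \<in> carrier_mat n n" "Q' \<in> carrier_mat n n"
    using Q(1) by (simp_all add: mutual_inverse_def)
  \<comment> \<open>First to the eigenbasis of the dual element by \<open>P\<close>, then to the
    bidiagonalizing basis by \<open>Q\<close>.\<close>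
  define f where "f z = (Q' * P') * (f0 z * (P * Q))" for z
  have f: "algebra_iso M (mat_algebra n) f"
    unfolding f_def
    by (rule algebra_iso_conj[OF mutual_inverse_mult[OF mutual_inverse_sym[OF Q(1)] mutual_inverse_sym[OF P(2)]] f0])
  have f0c [simp]: "f0 (elt \<Phi>) \<in> carrier_mat n n" "f0 (dual_elt \<Phi>) \<in> carrier_mat n n"
    using algebra_isoD(1)[OF f0] el by (simp_all add: module_mat_simps)
  have fA: "f (elt \<Phi>) = lower_bidiag n t (\<lambda>_. 1)"
    unfolding Q(2)[symmetric] by (simp add: f_def X_def assoc)
  have fAs: "f (dual_elt \<Phi>) = upper_bidiag n ts vp"
    unfolding Q(3)[symmetric] using mutual_inverse_cancel(2)[OF P(2), of _ n]
    by (simp add: f_def P(3) assoc)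
  have split: "split_form d M \<Phi> f vp"
    unfolding split_form_bidiag n[symmetric] fA fAs using f seq
    by (auto simp: lower_bidiag_def upper_bidiag_def intro!: eq_matI)
  have Yc [simp]: "Y \<in> carrier_mat n n" by (simp add: Y_def assoc)
  obtain k where k: "\<And>i. i < n \<Longrightarrow> k i \<noteq> 0" "diag_of n k * Y = transpose_mat Y * diag_of n k"
    using tridiag_symmetrizer[OF Yc Y_tri] by blast
  define K where "K = diag_of n k"
  \<comment> \<open>Conjugation by \<open>C\<close> turns the split form into
    \<open>diag_of n t\<close> and \<open>Y\<close>. There \<open>K\<close> intertwines both
    matrices with their transposes, and \<open>S\<close> is \<open>K\<close> pulled back along
    \<open>C\<close>.\<close>
  define S where "S = transpose_mat C * (K * C)"
  have Kc [simp]: "K \<in> carrier_mat n n" by (simp add: K_def)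
  note [simp] = C(1)
  have "det S = det C * (det K * det C)"
    by (simp add: S_def det_mult[of _ n] det_transpose[OF C(1)] assoc)
  moreover have "det K \<noteq> 0"
    unfolding K_def using k(1) by (intro mutual_inverse_det[OF mutual_inverse_diag]) auto
  moreover have "S \<in> carrier_mat n n" by (simp add: S_def assoc)
  ultimately obtain S' where S': "mutual_inverse n S S'"
    using mutual_inverse_of_det[of S n] C(2) by auto
  let ?L = "lower_bidiag n t (\<lambda>_. 1)"
  let ?U = "upper_bidiag n ts vp"
  have "S * ?L = transpose_mat C * (K * (C * ?L))" by (simp add: S_def assoc)
  also have "\<dots> = transpose_mat C * (diag_of n t * (K * C))"
    unfolding C(3)[symmetric] K_def
    by (simp add: assoc(1)[symmetric] diag_of_mult_diag_of assoc(2) mult.commute)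
  also have "\<dots> = transpose_mat (diag_of n t * C) * (K * C)"
    by (simp add: transpose_mult[of _ n n _ n] transpose_bidiag assoc)
  also have "\<dots> = transpose_mat ?L * S"
    unfolding C(3) by (simp add: transpose_mult[of _ n n _ n] S_def assoc)
  finally have SL: "S * ?L = transpose_mat ?L * S" .
  have "S * ?U = transpose_mat C * (K * (C * ?U))" by (simp add: S_def assoc)
  also have "\<dots> = transpose_mat C * (K * Y * C)" unfolding C(4) by (simp add: assoc)
  also have "\<dots> = transpose_mat (Y * C) * (K * C)"
    using k(2) by (simp add: K_def[symmetric] transpose_mult[of _ n n _ n] assoc)
  also have "\<dots> = transpose_mat ?U * S"
    unfolding C(4)[symmetric] by (simp add: transpose_mult[of _ n n _ n] S_def assoc)
  finally have SU: "S * ?U = transpose_mat ?U * S" .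
  have "inj_on (dual_eigenvalue_seq M \<Phi>) {..<n}"
    using P(1) seq(2) by (simp add: inj_on_def)
  with that[OF split Q(4) S'] SL SU show thesis by (simp add: fA fAs)
qed

section \<open>The action of the dihedral group\<close>

lemma tridiagonal_on_rev:
  assumes "length Es = d + 1" "tridiagonal_on d M Es x"
  shows "tridiagonal_on d M (rev Es) x"
  unfolding tridiagonal_on_def
proof (intro allI impI)
  fix i j assume ij: "i \<le> d" "j \<le> d"
  have "rev Es ! i = Es ! (d - i)" "rev Es ! j = Es ! (d - j)"
    using ij assms(1) by (simp_all add: rev_nth)
  moreover have "\<bar>int (d - i) - int (d - j)\<bar> = \<bar>int i - int j\<bar>"
    using ij by linarith
  ultimately show "(1 < \<bar>int i - int j\<bar> \<longrightarrow> rev Es ! i \<otimes>\<^bsub>M\<^esub> x \<otimes>\<^bsub>M\<^esub> rev Es ! j = \<zero>\<^bsub>M\<^esub>) \<and>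
      (\<bar>int i - int j\<bar> = 1 \<longrightarrow> rev Es ! i \<otimes>\<^bsub>M\<^esub> x \<otimes>\<^bsub>M\<^esub> rev Es ! j \<noteq> \<zero>\<^bsub>M\<^esub>)"
    using assms(2) ij unfolding tridiagonal_on_def by (metis diff_le_self)
qed

lemma leonard_system_length:
  assumes "leonard_system d M \<Phi>"
  shows "length (idems \<Phi>) = d + 1" "length (dual_idems \<Phi>) = d + 1"
  using assms by (simp_all add: leonard_system_def ordering_of_prim_idems_def)

lemma leonard_system_gen_act:
  assumes "leonard_system d M \<Phi>"
  shows "leonard_system d M (gen_act g \<Phi>)"
  using assms leonard_system_length[OF assms]
  by (cases \<Phi>; cases g)
     (auto simp: leonard_system_def ordering_of_prim_idems_def tridiagonal_on_rev)

lemma eigenvalue_seq_gen_act: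
  "eigenvalue_seq M (gen_act Star \<Phi>) = dual_eigenvalue_seq M \<Phi>"
  "dual_eigenvalue_seq M (gen_act Star \<Phi>) = eigenvalue_seq M \<Phi>"
  "eigenvalue_seq M (gen_act Down \<Phi>) = eigenvalue_seq M \<Phi>"
  "dual_eigenvalue_seq M (gen_act DDown \<Phi>) = dual_eigenvalue_seq M \<Phi>"
  by (cases \<Phi>; simp add: eigenvalue_seq_def dual_eigenvalue_seq_def fun_eq_iff)+

lemma eigenvalue_seq_gen_act_rev:
  assumes "leonard_system d M \<Phi>" "i \<le> d"
  shows "eigenvalue_seq M (gen_act DDown \<Phi>) i = eigenvalue_seq M \<Phi> (d - i)"
    "dual_eigenvalue_seq M (gen_act Down \<Phi>) i = dual_eigenvalue_seq M \<Phi> (d - i)"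
  using assms leonard_system_length[OF assms(1)]
  by (cases \<Phi>; simp add: eigenvalue_seq_def dual_eigenvalue_seq_def rev_nth)+

section \<open>Symmetries of the parameter sequences\<close>

lemma varphi_seq_eq:
  assumes \<Phi>: "leonard_system d M \<Phi>" and f: "split_form d M \<Phi> f vp" and i: "i \<in> {1..d}"
  shows "varphi_seq d M \<Phi> i = vp i"
proof -
  have "inj_on (dual_eigenvalue_seq M \<Phi>) {..<d + 1}"
    using leonard_system_split_form[OF HOL.refl \<Phi>] by blast
  then show ?thesis
    using \<Phi> f i by (intro varphi_seq_eqI[of M d \<Phi> f])
      (auto simp: leonard_system_def multiplicity_free_def inj_on_def)
qed

text \<open>The transposed split form of \<open>\<Phi>\<close>, brought back by the intertwiner \<open>S\<close> and rescaled by a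
  diagonal matrix, is a split form of \<open>\<Phi>\<^sup>*\<close>.\<close>

lemma varphi_seq_Star:
  fixes M :: "('k::field, 'a, 'm) module_scheme"
  assumes \<Phi>: "leonard_system d M \<Phi>" and i: "i \<in> {1..d}"
  shows "varphi_seq d M (gen_act Star \<Phi>) i = varphi_seq d M \<Phi> i"
proof -
  let ?n = "d + 1"
  obtain f vp S S' where f: "split_form d M \<Phi> f vp" and vp: "\<And>i. 0 < i \<Longrightarrow> i < ?n \<Longrightarrow> vp i \<noteq> 0"
    and S: "mutual_inverse ?n S S'"
    and SL: "S * f (elt \<Phi>) = transpose_mat (f (elt \<Phi>)) * S"
    and SU: "S * f (dual_elt \<Phi>) = transpose_mat (f (dual_elt \<Phi>)) * S"
    by (rule leonard_system_split_form[OF HOL.refl \<Phi>]) (rule that)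
  have fiso: "algebra_iso M (mat_algebra ?n) f"
    and fA: "f (elt \<Phi>) = lower_bidiag ?n (eigenvalue_seq M \<Phi>) (\<lambda>_. 1)"
    and fAs: "f (dual_elt \<Phi>) = upper_bidiag ?n (dual_eigenvalue_seq M \<Phi>) vp"
    using f by (simp_all add: split_form_bidiag)
  \<comment> \<open>Transposition reverses products, but conjugation by \<open>S\<close> is an
    isomorphism and agrees with it on the two elements in question.\<close>
  have conj: "S * (Z * S') = transpose_mat Z"
    if "S * Z = transpose_mat Z * S" "Z \<in> carrier_mat ?n ?n" for Z
  proof -
    have c: "S \<in> carrier_mat ?n ?n" "S' \<in> carrier_mat ?n ?n" "S * S' = 1\<^sub>m ?n"
      using S by (simp_all add: mutual_inverse_def)
    have "S * (Z * S') = S * Z * S'" by (rule assoc_mult_mat[OF c(1) that(2) c(2), symmetric])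
    also have "\<dots> = transpose_mat Z * (S * S')"
      unfolding that(1) using that(2) by (intro assoc_mult_mat[OF _ c(1,2)]) simp
    finally show ?thesis using that(2) c(3) by simp
  qed
  let ?g = "\<lambda>x. S * (f x * S')"
  have g: "algebra_iso M (mat_algebra ?n) ?g" by (rule algebra_iso_conj[OF S fiso])
  have gA: "?g (elt \<Phi>) = upper_bidiag ?n (eigenvalue_seq M \<Phi>) (\<lambda>_. 1)"
    using conj[OF SL] unfolding fA by (simp add: transpose_bidiag)
  have gAs: "?g (dual_elt \<Phi>) = lower_bidiag ?n (dual_eigenvalue_seq M \<Phi>) vp"
    using conj[OF SU] unfolding fAs by (simp add: transpose_bidiag)
  obtain h where h: "algebra_iso M (mat_algebra ?n) h"
    "h (elt \<Phi>) = upper_bidiag ?n (eigenvalue_seq M \<Phi>) vp"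
    "h (dual_elt \<Phi>) = lower_bidiag ?n (dual_eigenvalue_seq M \<Phi>) (\<lambda>_. 1)"
    using bidiag_pair_rescale[OF g gA gAs vp] by blast
  have "elt (gen_act Star \<Phi>) = dual_elt \<Phi>" "dual_elt (gen_act Star \<Phi>) = elt \<Phi>"
    by (cases \<Phi>; simp)+
  then have "split_form d M (gen_act Star \<Phi>) h vp"
    using h by (simp add: split_form_bidiag eigenvalue_seq_gen_act)
  then have "varphi_seq d M (gen_act Star \<Phi>) i = vp i"
    by (rule varphi_seq_eq[OF leonard_system_gen_act[OF \<Phi>] _ i])
  then show ?thesis using varphi_seq_eq[OF \<Phi> f i] by simp
qed

text \<open>Reversing the basis of a split form makes the element upper and the dual element lower
  bidiagonal. After rescaling this is a split form of the doubly reversed system with its two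
  elements exchanged, and the symmetry under \<open>Star\<close> undoes the exchange.\<close>

lemma varphi_seq_Down_DDown:
  fixes M :: "('k::field, 'a, 'm) module_scheme"
  assumes \<Phi>: "leonard_system d M \<Phi>" and i: "i \<in> {1..d}"
  shows "varphi_seq d M (gen_act Down (gen_act DDown \<Phi>)) i = varphi_seq d M \<Phi> (d - i + 1)"
proof -
  let ?n = "d + 1" and ?\<Psi> = "gen_act Down (gen_act DDown \<Phi>)"
  have \<Psi>: "leonard_system d M ?\<Psi>" using \<Phi> by (simp add: leonard_system_gen_act)
  obtain f vp where f: "split_form d M \<Phi> f vp" and vp: "\<And>i. 0 < i \<Longrightarrow> i < ?n \<Longrightarrow> vp i \<noteq> 0"
    by (rule leonard_system_split_form[OF HOL.refl \<Phi>]) (rule that)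
  have fiso: "algebra_iso M (mat_algebra ?n) f"
    and fA: "f (elt \<Phi>) = lower_bidiag ?n (eigenvalue_seq M \<Phi>) (\<lambda>_. 1)"
    and fAs: "f (dual_elt \<Phi>) = upper_bidiag ?n (dual_eigenvalue_seq M \<Phi>) vp"
    using f by (simp_all add: split_form_bidiag)
  have el: "elt \<Phi> \<in> carrier M" "dual_elt \<Phi> \<in> carrier M"
    using \<Phi> by (simp_all add: leonard_system_def multiplicity_free_def)
  have seq: "eigenvalue_seq M ?\<Psi> j = eigenvalue_seq M \<Phi> (d - j)"
    "dual_eigenvalue_seq M ?\<Psi> j = dual_eigenvalue_seq M \<Phi> (d - j)" if "j \<le> d" for j
    using eigenvalue_seq_gen_act_rev(1)[OF \<Phi> that]
      eigenvalue_seq_gen_act_rev(2)[OF leonard_system_gen_act[OF \<Phi>] that, of DDown]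
    by (simp_all add: eigenvalue_seq_gen_act)
  obtain g where g: "algebra_iso M (mat_algebra ?n) g"
    "\<And>x. x \<in> carrier M \<Longrightarrow> g x = mat ?n ?n (\<lambda>(i, j). f x $$ (?n - 1 - i, ?n - 1 - j))"
    by (rule algebra_iso_reverse[OF fiso]) (rule that)
  \<comment> \<open>Reversal sends position \<open>(j - 1, j)\<close> to
    \<open>(d - j + 1, d - j)\<close>, so the subdiagonal entry in row \<open>i\<close> is
    \<open>vp (d - i + 1)\<close>.\<close>
  let ?w = "\<lambda>j. vp (d - j + 1)"
  have gA: "g (elt \<Phi>) = upper_bidiag ?n (eigenvalue_seq M ?\<Psi>) (\<lambda>_. 1)"
    unfolding g(2)[OF el(1)] fA
    by (rule eq_matI) (auto simp: lower_bidiag_def upper_bidiag_def seq)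
  have gAs: "g (dual_elt \<Phi>) = lower_bidiag ?n (dual_eigenvalue_seq M ?\<Psi>) ?w"
    unfolding g(2)[OF el(2)] fAs
    by (rule eq_matI) (auto simp: lower_bidiag_def upper_bidiag_def seq Suc_diff_Suc)
  have w: "?w j \<noteq> 0" if "0 < j" "j < ?n" for j using that by (intro vp) auto
  obtain h where h: "algebra_iso M (mat_algebra ?n) h"
    "h (elt \<Phi>) = upper_bidiag ?n (eigenvalue_seq M ?\<Psi>) ?w"
    "h (dual_elt \<Phi>) = lower_bidiag ?n (dual_eigenvalue_seq M ?\<Psi>) (\<lambda>_. 1)"
    using bidiag_pair_rescale[OF g(1) gA gAs w] by blast
  have "elt (gen_act Star ?\<Psi>) = dual_elt \<Phi>" "dual_elt (gen_act Star ?\<Psi>) = elt \<Phi>"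
    by (cases \<Phi>; simp)+
  then have "split_form d M (gen_act Star ?\<Psi>) h ?w"
    using h by (simp add: split_form_bidiag eigenvalue_seq_gen_act(1,2))
  then have "varphi_seq d M (gen_act Star ?\<Psi>) i = vp (d - i + 1)"
    by (rule varphi_seq_eq[OF leonard_system_gen_act[OF \<Psi>] _ i])
  moreover have "varphi_seq d M \<Phi> (d - i + 1) = vp (d - i + 1)"
    using i by (intro varphi_seq_eq[OF \<Phi> f]) auto
  ultimately show ?thesis using varphi_seq_Star[OF \<Psi> i] by simp
qed

section \<open>Words in the generators and the rows of the table\<close>

lemma gen_act_relations:
  "gen_act g (gen_act g \<Phi>) = \<Phi>"
  "gen_act Down (gen_act Star \<Phi>) = gen_act Star (gen_act DDown \<Phi>)"
  "gen_act DDown (gen_act Star \<Phi>) = gen_act Star (gen_act Down \<Phi>)"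
  "gen_act DDown (gen_act Down \<Phi>) = gen_act Down (gen_act DDown \<Phi>)"
  by (cases \<Phi>; cases g; simp)+

text \<open>The double reversal applied to \<open>gen_act DDown \<Phi>\<close> is a single one,
  since the two \<open>DDown\<close> cancel.\<close>

lemma varphi_seq_Down:
  assumes \<Phi>: "leonard_system d M \<Phi>" and i: "i \<in> {1..d}"
  shows "varphi_seq d M (gen_act Down \<Phi>) i = phi_seq d M \<Phi> (d - i + 1)"
  using varphi_seq_Down_DDown[OF leonard_system_gen_act[OF \<Phi>] i, of DDown]
  by (simp add: gen_act_relations(1) phi_seq_def)

lemma conj_obj_one: "conj_obj F \<Phi> one4 = F \<Phi>"
proof -
  interpret D4: group D4 by (rule group_D4)
  show ?thesis by (simp add: conj_obj_def lsys_act_one)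
qed

text \<open>Inversion reverses a word and fixes each generator, so the last letter is the first to
  act on \<open>\<Phi>\<close>. Peeling letters off from the right turns every
  \<open>conj_obj\<close> into plain generator actions.\<close>

lemma conj_obj_mult_gen: "conj_obj F \<Phi> (g \<cdot> d4_gen x) = conj_obj F (gen_act x \<Phi>) g"
proof -
  interpret D4: group D4 by (rule group_D4)
  have c [simp]: "y \<in> carrier D4" for y by (simp add: D4_def)
  have "d4_gen x \<cdot> d4_gen x = one4" by (cases x) (simp_all add: d4_relations)
  then have "inv\<^bsub>D4\<^esub> (d4_gen x) = d4_gen x" by (simp add: D4.inv_equality)
  then show ?thesis by (simp add: conj_obj_def D4.inv_mult_group lsys_act_mult lsys_act_gen)
qed

lemma conj_obj_gen: "conj_obj F \<Phi> (d4_gen x) = F (gen_act x \<Phi>)"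
proof -
  interpret D4: group D4 by (rule group_D4)
  have "one4 \<cdot> d4_gen x = d4_gen x" by (rule D4.l_one) (simp add: D4_def)
  then show ?thesis using conj_obj_mult_gen[of F \<Phi> one4 x] by (simp add: conj_obj_one)
qed

theorem theorem1p11:
  fixes \<A> :: "('k::field, 'a, 'm) module_scheme"
    and \<Phi> :: "'a lsys"
    and d :: nat
    and \<theta> \<theta>s vphi phi :: "nat \<Rightarrow> 'k"
  assumes "leonard_system d \<A> \<Phi>"
    and "\<theta> = eigenvalue_seq \<A> \<Phi>"
    and "\<theta>s = dual_eigenvalue_seq \<A> \<Phi>"
    and "vphi = varphi_seq d \<A> \<Phi>"
    and "phi = phi_seq d \<A> \<Phi>"
  shows
    "table_row d \<A> \<Phi> one4
       (\<lambda>i. \<theta> i) (\<lambda>i. \<theta>s i) (\<lambda>i. vphi i) (\<lambda>i. phi i) \<and>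
     table_row d \<A> \<Phi> down
       (\<lambda>i. \<theta> i) (\<lambda>i. \<theta>s (d - i)) (\<lambda>i. phi (d - i + 1)) (\<lambda>i. vphi (d - i + 1)) \<and>
     table_row d \<A> \<Phi> ddown
       (\<lambda>i. \<theta> (d - i)) (\<lambda>i. \<theta>s i) (\<lambda>i. phi i) (\<lambda>i. vphi i) \<and>
     table_row d \<A> \<Phi> (down \<cdot> ddown)
       (\<lambda>i. \<theta> (d - i)) (\<lambda>i. \<theta>s (d - i)) (\<lambda>i. vphi (d - i + 1)) (\<lambda>i. phi (d - i + 1)) \<and>
     table_row d \<A> \<Phi> star
       (\<lambda>i. \<theta>s i) (\<lambda>i. \<theta> i) (\<lambda>i. vphi i) (\<lambda>i. phi (d - i + 1)) \<and>
     table_row d \<A> \<Phi> (down \<cdot> star)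
       (\<lambda>i. \<theta>s i) (\<lambda>i. \<theta> (d - i)) (\<lambda>i. phi i) (\<lambda>i. vphi (d - i + 1)) \<and>
     table_row d \<A> \<Phi> (ddown \<cdot> star)
       (\<lambda>i. \<theta>s (d - i)) (\<lambda>i. \<theta> i) (\<lambda>i. phi (d - i + 1)) (\<lambda>i. vphi i) \<and>
     table_row d \<A> \<Phi> (down \<cdot> ddown \<cdot> star)
       (\<lambda>i. \<theta>s (d - i)) (\<lambda>i. \<theta> (d - i)) (\<lambda>i. vphi (d - i + 1)) (\<lambda>i. phi i)"
proof -
  note \<Phi> = assms(1)
  note L = leonard_system_gen_act[OF \<Phi>] leonard_system_gen_act[OF leonard_system_gen_act[OF \<Phi>]]
  have varphi: "varphi_seq d \<A> (gen_act DDown \<Phi>) i = phi i"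
    "varphi_seq d \<A> (gen_act Down \<Phi>) i = phi (d - i + 1)"
    "varphi_seq d \<A> (gen_act Down (gen_act DDown \<Phi>)) i = vphi (d - i + 1)"
    if "i \<in> {1..d}" for i
    using that varphi_seq_Down[OF \<Phi>] varphi_seq_Down_DDown[OF \<Phi>] assms(4,5)
    by (simp_all add: phi_seq_def)
  have seq: "eigenvalue_seq \<A> (gen_act DDown \<Phi>) i = \<theta> (d - i)"
    "dual_eigenvalue_seq \<A> (gen_act Down \<Phi>) i = \<theta>s (d - i)"
    "dual_eigenvalue_seq \<A> (gen_act Down (gen_act DDown \<Phi>)) i = \<theta>s (d - i)"
    if "i \<in> {0..d}" for i
    using that assms(2,3) eigenvalue_seq_gen_act_rev[OF \<Phi>] eigenvalue_seq_gen_act_rev(2)[OF L(1)]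
    by (simp_all add: eigenvalue_seq_gen_act)
  show ?thesis
    \<comment> \<open>The relations move \<open>Star\<close> outermost, where it drops out of
      \<open>varphi_seq\<close> or swaps the two eigenvalue sequences. What remains are systems that
      differ from \<open>\<Phi>\<close> in the orderings only, treated in \<open>varphi\<close> and
      \<open>seq\<close>.\<close>
    unfolding table_row_def conj_obj_one conj_obj_gen conj_obj_mult_gen phi_seq_def
    by (simp add: L \<Phi> varphi varphi_seq_Star gen_act_relations eigenvalue_seq_gen_act
        seq assms(2-4)[symmetric] del: One_nat_def)
qed

end
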